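(* Let $F : (0,\infty) \to (0,\infty)$. For each of the following three classes, the composition transform $C_F : \Lambda \mapsto F \circ \Lambda$ preserves the class if and only if there exists $c > 0$ such that $F(x) = cx$ for all $x$ (so that $C_F$ preserves any one of the classes if and only if it preserves all of them): (a) totally positive Pólya frequency functions; (b) totally positive Pólya frequency sequences; (c) totally positive functions $\mathbb{R} \to \mathbb{R}$.
   Context: A function $\Lambda : \mathbb{R} \to \mathbb{R}$ is totally positive if for every $n \geq 1$ and all reals $x_1 < \cdots < x_n$, $y_1 < \cdots < y_n$ one has $\det(\Lambda(x_i - y_j))_{i,j=1}^n > 0$ (in particular $\Lambda > 0$). A totally positive Pólya frequency function is a totally positive function $\mathbb{R} \to \mathbb{R}$ that is Lebesgue integrable. A totally positive Pólya frequency sequence is a function $\Lambda : \mathbb{Z} \to \mathbb{R}$ such that the same determinants are positive for all integers $x_1 < \cdots < x_n$, $y_1 < \cdots < y_n$ and all $n \geq 1$. $C_F$ preserves a class if $F \circ \Lambda$ belongs to the class for every $\Lambda$ in the class. *)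

theory Defs
  imports "HOL-Analysis.Analysis" "Jordan_Normal_Form.Determinant"
begin

text \<open>
  The definition is used for \<open>'a = real\<close> and \<open>'a = int\<close>. Both HOL-Analysis and
  Jordan_Normal_Form define \<open>mat\<close> and \<open>det\<close>; the latter's are meant, since the size
  \<open>n\<close> is quantified over. Rows and columns are indexed from 0.
\<close>

definition totally_positive :: "('a::linordered_idom \<Rightarrow> real) \<Rightarrow> bool" where
  "totally_positive \<Lambda> \<longleftrightarrow>
     (\<forall>n\<ge>1. \<forall>x y :: nat \<Rightarrow> 'a.
        strict_mono_on {..<n} x \<longrightarrow> strict_mono_on {..<n} y \<longrightarrow>
        Determinant.det (Matrix.mat n n (\<lambda>(i, j). \<Lambda> (x i - y j))) > 0)"

definition TP_functions :: "(real \<Rightarrow> real) set" where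
  "TP_functions = {\<Lambda>. totally_positive \<Lambda>}"

definition TP_Polya_frequency_functions :: "(real \<Rightarrow> real) set" where
  "TP_Polya_frequency_functions = {\<Lambda>. totally_positive \<Lambda> \<and> integrable lebesgue \<Lambda>}"

definition TP_Polya_frequency_sequences :: "(int \<Rightarrow> real) set" where
  "TP_Polya_frequency_sequences = {\<Lambda>. totally_positive \<Lambda>}"

text \<open>
  A function \<open>F : (0,\<infinity>) \<rightarrow> (0,\<infinity>)\<close> is represented by a function on all reals. Totally positive
  functions take only positive values (case \<open>n = 1\<close>), so on the classes above this does
  not depend on the values of \<open>F\<close> outside \<open>(0,\<infinity>)\<close>.
\<close>

definition composition_preserves :: "(real \<Rightarrow> real) \<Rightarrow> ('a \<Rightarrow> real) set \<Rightarrow> bool" where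
  "composition_preserves F \<C> \<longleftrightarrow> (\<forall>\<Lambda>\<in>\<C>. F \<circ> \<Lambda> \<in> \<C>)"

end

theory Submission
  imports Defs "HOL-Real_Asymp.Real_Asymp"
begin

text \<open>
  Any of the three hypotheses gives: for every integrable totally positive \<open>\<Lambda>\<close> on the reals,
  \<open>F \<circ> \<Lambda>\<close> restricted to the integers is totally positive. Testing \<open>2 \<times> 2\<close> minors of
  \<open>c * exp (\<gamma> x) / cosh (\<beta> x)\<close> (totally positive by Cauchy's determinant) shows that \<open>F\<close> is
  strictly increasing and continuous. Hence \<open>F \<circ> \<Lambda>\<close> has nonnegative minors also for limits
  \<open>\<Lambda>\<close> of such functions. Convolution with one-sided exponentials preserves total
  positivity, and so supplies two such limits.

  For \<open>\<Lambda> = L * exp (- \<bar>x\<bar>)\<close> the \<open>2 \<times> 2\<close> minors say that \<open>t \<mapsto> ln (F (exp t))\<close> is concave; a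
  \<open>3 \<times> 3\<close> minor that vanishes for the identity has first variation of the opposite sign, so this
  function is affine and \<open>F x = c * x powr p\<close>. For the convolution of \<open>exp (- \<bar>x\<bar>)\<close> with a
  one-sided exponential, \<open>4 \<times> 4\<close> minors with three of the column points sent to infinity equal
  \<open>- (p - 1)\<close> times a third difference of a function of \<open>u = exp (2 * x)\<close>, up to a positive
  factor. That third difference is negative on the smooth branch \<open>u powr (- p)\<close> and positive
  across the point \<open>u = 1\<close>, where the second derivative jumps up; so \<open>p = 1\<close>.
\<close>

section \<open>Determinants of finite kernels\<close>

definition kdet :: "nat \<Rightarrow> (nat \<Rightarrow> nat \<Rightarrow> real) \<Rightarrow> real" where
  "kdet n A = Determinant.det (Matrix.mat n n (\<lambda>(i, j). A i j))"

lemma kdet_cong: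
  assumes "\<And>i j. i < n \<Longrightarrow> j < n \<Longrightarrow> A i j = B i j"
  shows "kdet n A = kdet n B"
  unfolding kdet_def by (rule arg_cong[of _ _ Determinant.det]) (auto simp: assms)

lemma kdet_leibniz:
  "kdet n A = (\<Sum>p | p permutes {0..<n}. signof p * (\<Prod>i = 0..<n. A i (p i)))"
proof -
  have "kdet n A = (\<Sum>p | p permutes {0..<n}. signof p *
      (\<Prod>i = 0..<n. Matrix.mat n n (\<lambda>(i, j). A i j) $$ (i, p i)))"
    unfolding kdet_def by (rule det_def') auto
  also have "\<dots> = (\<Sum>p | p permutes {0..<n}. signof p * (\<Prod>i = 0..<n. A i (p i)))"
    by (intro sum.cong refl arg_cong2[of _ _ _ _ "(*)"] prod.cong)
       (auto dest: permutes_in_image)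
  finally show ?thesis .
qed

lemma tendsto_kdet:
  assumes "\<And>i j. i < n \<Longrightarrow> j < n \<Longrightarrow> ((\<lambda>t. A t i j) \<longlongrightarrow> B i j) G"
  shows "((\<lambda>t. kdet n (A t)) \<longlongrightarrow> kdet n B) G"
  unfolding kdet_leibniz
  by (intro tendsto_sum tendsto_mult tendsto_const tendsto_prod assms)
     (auto dest: permutes_in_image)

text \<open>Each permutation product meets every row and every column once. This is how exponential
  kernels and factors depending on one variable alone are stripped off later.\<close>

lemma kdet_scale:
  "kdet n (\<lambda>i j. a i * b j * A i j) = (\<Prod>i<n. a i) * (\<Prod>j<n. b j) * kdet n A"
proof -
  have "(\<Prod>i = 0..<n. a i * b (p i) * A i (p i)) =
      (\<Prod>i<n. a i) * (\<Prod>j<n. b j) * (\<Prod>i = 0..<n. A i (p i))" if "p permutes {0..<n}" for p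
  proof -
    have "(\<Prod>i = 0..<n. b (p i)) = (\<Prod>i = 0..<n. b i)"
      using prod.permute[OF that, of b] by (simp add: o_def)
    then show ?thesis
      by (simp add: prod.distrib atLeast0LessThan)
  qed
  then show ?thesis
    unfolding kdet_leibniz sum_distrib_left by (intro sum.cong) (auto simp: mult_ac)
qed

lemma kdet_identical_rows:
  assumes "i < n" "k < n" "i \<noteq> k" "\<And>j. j < n \<Longrightarrow> A i j = A k j"
  shows "kdet n A = 0"
  unfolding kdet_def
  by (rule det_identical_rows[of _ n i k]) (use assms in \<open>auto intro!: eq_vecI\<close>)

text \<open>\<open>C\<close> holds the cofactors of row \<open>k\<close>, which do not see that row.
  One \<open>C\<close> for all \<open>r\<close> lets the determinant be differentiated in the sample
  point of that row.\<close>

lemma kdet_row_linear: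
  assumes "k < n"
  obtains C where "\<And>r. kdet n (\<lambda>i j. if i = k then r j else A i j) = (\<Sum>j<n. r j * C j)"
proof
  fix r
  let ?M = "\<lambda>r. Matrix.mat n n (\<lambda>(i, j). if i = k then r j else A i j)"
  have "kdet n (\<lambda>i j. if i = k then r j else A i j) = (\<Sum>j<n. ?M r $$ (k, j) * cofactor (?M r) k j)"
    unfolding kdet_def by (rule laplace_expansion_row[OF _ assms]) auto
  also have "\<dots> = (\<Sum>j<n. r j * cofactor (?M (\<lambda>_. 0)) k j)"
  proof (intro sum.cong refl)
    fix j assume j: "j \<in> {..<n}"
    have "mat_delete (?M r) k j = mat_delete (?M (\<lambda>_. 0)) k j"
      unfolding mat_delete_def by (rule eq_matI) auto
    then show "?M r $$ (k, j) * cofactor (?M r) k j = r j * cofactor (?M (\<lambda>_. 0)) k j"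
      using j assms by (simp add: cofactor_def)
  qed
  finally show "kdet n (\<lambda>i j. if i = k then r j else A i j) =
    (\<Sum>j<n. r j * cofactor (?M (\<lambda>_. 0)) k j)" .
qed

lemma kdet_0 [simp]: "kdet 0 A = 1"
  by (simp add: kdet_def)

lemma kdet_Suc:
  "kdet (Suc n) A =
    (\<Sum>j<Suc n. A 0 j * ((- 1) ^ j * kdet n (\<lambda>i k. A (Suc i) (if k < j then k else Suc k))))"
proof -
  let ?M = "Matrix.mat (Suc n) (Suc n) (\<lambda>(i, j). A i j)"
  have "kdet (Suc n) A = (\<Sum>j<Suc n. ?M $$ (0, j) * cofactor ?M 0 j)"
    unfolding kdet_def by (rule laplace_expansion_row) auto
  also have "\<dots> = (\<Sum>j<Suc n. A 0 j * ((- 1) ^ j * kdet n (\<lambda>i k. A (Suc i) (if k < j then k else Suc k))))"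
  proof (intro sum.cong refl)
    fix j assume j: "j \<in> {..<Suc n}"
    have "mat_delete ?M 0 j = Matrix.mat n n (\<lambda>(i, k). A (Suc i) (if k < j then k else Suc k))"
      unfolding mat_delete_def by (rule eq_matI) auto
    then show "?M $$ (0, j) * cofactor ?M 0 j =
        A 0 j * ((- 1) ^ j * kdet n (\<lambda>i k. A (Suc i) (if k < j then k else Suc k)))"
      using j by (simp add: cofactor_def kdet_def)
  qed
  finally show ?thesis .
qed

lemma kdet_1: "kdet 1 A = A 0 0"
  by (simp add: kdet_Suc One_nat_def del: One_nat_def[symmetric])

lemma kdet_2: "kdet 2 A = A 0 0 * A 1 1 - A 0 1 * A 1 0"
  by (simp add: kdet_Suc numeral_2_eq_2)

lemma kdet_3:
  "kdet 3 A = A 0 0 * (A 1 1 * A 2 2 - A 1 2 * A 2 1)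
    - A 0 1 * (A 1 0 * A 2 2 - A 1 2 * A 2 0) + A 0 2 * (A 1 0 * A 2 1 - A 1 1 * A 2 0)"
  by (simp add: kdet_Suc numeral_2_eq_2 numeral_3_eq_3 algebra_simps)

lemma kdet_4:
  "kdet 4 A =
      A 0 0 * (A 1 1 * (A 2 2 * A 3 3 - A 2 3 * A 3 2) - A 1 2 * (A 2 1 * A 3 3 - A 2 3 * A 3 1)
        + A 1 3 * (A 2 1 * A 3 2 - A 2 2 * A 3 1))
    - A 0 1 * (A 1 0 * (A 2 2 * A 3 3 - A 2 3 * A 3 2) - A 1 2 * (A 2 0 * A 3 3 - A 2 3 * A 3 0)
        + A 1 3 * (A 2 0 * A 3 2 - A 2 2 * A 3 0))
    + A 0 2 * (A 1 0 * (A 2 1 * A 3 3 - A 2 3 * A 3 1) - A 1 1 * (A 2 0 * A 3 3 - A 2 3 * A 3 0)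
        + A 1 3 * (A 2 0 * A 3 1 - A 2 1 * A 3 0))
    - A 0 3 * (A 1 0 * (A 2 1 * A 3 2 - A 2 2 * A 3 1) - A 1 1 * (A 2 0 * A 3 2 - A 2 2 * A 3 0)
        + A 1 2 * (A 2 0 * A 3 1 - A 2 1 * A 3 0))"
proof -
  have 4: "(4::nat) = Suc (Suc (Suc (Suc 0)))" by simp
  show ?thesis by (simp add: kdet_Suc 4 numeral_2_eq_2 numeral_3_eq_3 algebra_simps)
qed

text \<open>Schur complement: the matrix is a block upper triangular matrix with diagonal blocks
  \<open>?S\<close> and \<open>?d\<close>, times a unipotent block lower triangular one.\<close>

lemma kdet_pivot:
  assumes "A n n \<noteq> 0"
  shows "kdet (Suc n) A = A n n * kdet n (\<lambda>i j. A i j - A i n * A n j / A n n)"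
proof -
  let ?d = "A n n"
  let ?S = "Matrix.mat n n (\<lambda>(i, j). A i j - A i n * A n j / ?d)"
  let ?P = "four_block_mat ?S (Matrix.mat n 1 (\<lambda>(i, j). A i n)) (0\<^sub>m 1 n) (Matrix.mat 1 1 (\<lambda>_. ?d))"
  let ?Q = "four_block_mat (1\<^sub>m n) (0\<^sub>m n 1) (Matrix.mat 1 n (\<lambda>(i, j). A n j / ?d)) (1\<^sub>m 1)"
  have P: "?P \<in> carrier_mat (n + 1) (n + 1)" by (intro four_block_carrier_mat) auto
  have Q: "?Q \<in> carrier_mat (n + 1) (n + 1)" by (intro four_block_carrier_mat) auto
  have "Matrix.mat (Suc n) (Suc n) (\<lambda>(i, j). A i j) = ?P * ?Q"
  proof (subst mult_four_block_mat[of _ n n _ 1 _ 1 _ _ n _ 1], goal_cases)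
    case 9
    show ?case
      by (rule eq_matI) (use assms in \<open>auto simp: scalar_prod_def less_Suc_eq\<close>)
  qed auto
  moreover have "Determinant.det ?P = Determinant.det ?S * ?d"
    by (subst det_four_block_mat_lower_left_zero[of _ n _ 1]) (auto simp: det_single)
  moreover have "Determinant.det ?Q = 1"
    by (subst det_four_block_mat_upper_right_zero[of _ n _ 1]) auto
  ultimately show ?thesis
    unfolding kdet_def by (simp del: One_nat_def add: det_mult[OF P Q])
qed

text \<open>Pivoting on the last entry of a Cauchy matrix leaves the smaller Cauchy matrix, up to
  row and column factors that are positive because \<open>a\<close> and \<open>b\<close>
  increase.\<close>

lemma kdet_cauchy_pos:
  assumes "\<And>i j. i < j \<Longrightarrow> j < n \<Longrightarrow> a i < a j" "\<And>i j. i < j \<Longrightarrow> j < n \<Longrightarrow> b i < b j"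
    and "\<And>i. i < n \<Longrightarrow> a i > 0" "\<And>i. i < n \<Longrightarrow> b i > 0"
  shows "kdet n (\<lambda>i j. 1 / (a i + b j)) > 0"
  using assms
proof (induction n)
  case (Suc n)
  have pos: "a i + b j > 0" if "i \<le> n" "j \<le> n" for i j
    using Suc.prems(3)[of i] Suc.prems(4)[of j] that by simp
  have "kdet n (\<lambda>i j. 1 / (a i + b j) - 1 / (a i + b n) * (1 / (a n + b j)) / (1 / (a n + b n)))
      = kdet n (\<lambda>i j. ((a n - a i) / (a i + b n)) * ((b n - b j) / (a n + b j)) * (1 / (a i + b j)))"
  proof (rule kdet_cong, goal_cases)
    case (1 i j)
    then have "a i + b j \<noteq> 0" "a i + b n \<noteq> 0" "a n + b j \<noteq> 0" "a n + b n \<noteq> 0"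
      using pos[of i j] pos[of i n] pos[of n j] pos[of n n] by auto
    then show ?case
      by (simp add: frac_eq_eq diff_frac_eq) (simp add: algebra_simps)
  qed
  also have "\<dots> = (\<Prod>i<n. (a n - a i) / (a i + b n)) * (\<Prod>j<n. (b n - b j) / (a n + b j))
      * kdet n (\<lambda>i j. 1 / (a i + b j))"
    by (rule kdet_scale)
  also have "\<dots> > 0"
    using Suc pos by (intro mult_pos_pos prod_pos divide_pos_pos ballI Suc.IH) auto
  finally show ?case
    using pos[of n n] by (subst kdet_pivot) auto
qed simp

section \<open>Totally positive functions\<close>

lemma totally_positive_iff:
  "totally_positive \<Lambda> \<longleftrightarrow>
    (\<forall>n x y. strict_mono_on {..<n} x \<longrightarrow> strict_mono_on {..<n} y \<longrightarrow>
      kdet n (\<lambda>i j. \<Lambda> (x i - y j)) > 0)"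
proof
  assume tp: "totally_positive \<Lambda>"
  show "\<forall>n x y. strict_mono_on {..<n} x \<longrightarrow> strict_mono_on {..<n} y \<longrightarrow>
      kdet n (\<lambda>i j. \<Lambda> (x i - y j)) > 0"
  proof (intro allI impI)
    fix n and x y :: "nat \<Rightarrow> 'a"
    assume *: "strict_mono_on {..<n} x" "strict_mono_on {..<n} y"
    show "kdet n (\<lambda>i j. \<Lambda> (x i - y j)) > 0"
    proof (cases "n = 0")
      case False
      then have "1 \<le> n" by simp
      from tp[unfolded totally_positive_def, rule_format, OF this *] show ?thesis
        by (simp only: kdet_def)
    qed (simp only: kdet_0 zero_less_one)
  qed
next
  assume pos: "\<forall>n x y. strict_mono_on {..<n} x \<longrightarrow> strict_mono_on {..<n} y \<longrightarrow>
      kdet n (\<lambda>i j. \<Lambda> (x i - y j)) > 0"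
  show "totally_positive \<Lambda>"
    unfolding totally_positive_def
    by (intro allI impI pos[unfolded kdet_def, rule_format])
qed

lemma totally_positive_imp_pos:
  assumes "totally_positive \<Lambda>"
  shows "\<Lambda> z > 0"
proof -
  have "kdet 1 (\<lambda>i j. \<Lambda> ((\<lambda>_. z) i - (\<lambda>_. 0) j)) > 0"
    by (rule assms[unfolded totally_positive_iff, rule_format]) (auto simp: strict_mono_on_def)
  then show ?thesis
    by (simp only: kdet_1 diff_0_right)
qed

lemma totally_positive_cmult:
  assumes "totally_positive \<Lambda>" "c > 0"
  shows "totally_positive (\<lambda>z. c * \<Lambda> z)"
  unfolding totally_positive_iff
proof (intro allI impI)
  fix n and x y :: "nat \<Rightarrow> 'a"
  assume "strict_mono_on {..<n} x" "strict_mono_on {..<n} y"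
  then have "kdet n (\<lambda>i j. \<Lambda> (x i - y j)) > 0"
    using assms unfolding totally_positive_iff by blast
  then show "kdet n (\<lambda>i j. c * \<Lambda> (x i - y j)) > 0"
    using kdet_scale[of n "\<lambda>_. c" "\<lambda>_. 1" "\<lambda>i j. \<Lambda> (x i - y j)"] assms(2) by simp
qed

lemma totally_positive_mult_exp:
  fixes \<Lambda> :: "real \<Rightarrow> real"
  assumes "totally_positive \<Lambda>"
  shows "totally_positive (\<lambda>z. exp (a * z) * \<Lambda> z)"
  unfolding totally_positive_iff
proof (intro allI impI)
  fix n and x y :: "nat \<Rightarrow> real"
  assume "strict_mono_on {..<n} x" "strict_mono_on {..<n} y"
  then have pos: "kdet n (\<lambda>i j. \<Lambda> (x i - y j)) > 0"
    using assms unfolding totally_positive_iff by blast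
  have "kdet n (\<lambda>i j. exp (a * (x i - y j)) * \<Lambda> (x i - y j)) =
      kdet n (\<lambda>i j. exp (a * x i) * exp (- a * y j) * \<Lambda> (x i - y j))"
    by (rule kdet_cong) (simp add: algebra_simps flip: exp_add)
  also have "\<dots> = (\<Prod>i<n. exp (a * x i)) * (\<Prod>j<n. exp (- a * y j)) * kdet n (\<lambda>i j. \<Lambda> (x i - y j))"
    by (rule kdet_scale)
  also have "\<dots> > 0"
    using pos by (intro mult_pos_pos prod_pos) auto
  finally show "kdet n (\<lambda>i j. exp (a * (x i - y j)) * \<Lambda> (x i - y j)) > 0" .
qed

lemma totally_positive_dilate:
  fixes \<Lambda> :: "real \<Rightarrow> real"
  assumes "totally_positive \<Lambda>" "m > 0"
  shows "totally_positive (\<lambda>z. \<Lambda> (m * z))"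
  unfolding totally_positive_iff
proof (intro allI impI)
  fix n and x y :: "nat \<Rightarrow> real"
  assume "strict_mono_on {..<n} x" "strict_mono_on {..<n} y"
  then have "strict_mono_on {..<n} (\<lambda>i. m * x i)" "strict_mono_on {..<n} (\<lambda>i. m * y i)"
    using assms(2) by (auto simp: strict_mono_on_def)
  then have "kdet n (\<lambda>i j. \<Lambda> (m * x i - m * y j)) > 0"
    using assms(1) unfolding totally_positive_iff by blast
  then show "kdet n (\<lambda>i j. \<Lambda> (m * (x i - y j))) > 0"
    by (simp add: algebra_simps)
qed

text \<open>Up to row and column factors this is the Cauchy kernel in \<open>exp (2 * b * x)\<close>
  and \<open>exp (2 * b * y)\<close>.\<close>

lemma totally_positive_sech:
  assumes "b > 0"
  shows "totally_positive (\<lambda>z::real. 1 / (exp (b * z) + exp (- b * z)))"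
  unfolding totally_positive_iff
proof (intro allI impI)
  fix n and x y :: "nat \<Rightarrow> real"
  assume xy: "strict_mono_on {..<n} x" "strict_mono_on {..<n} y"
  have eq: "1 / (exp (b * (u - v)) + exp (- b * (u - v))) =
      exp (b * u) * exp (b * v) * (1 / (exp (2 * b * u) + exp (2 * b * v)))" for u v
  proof -
    have "exp (2 * b * u) + exp (2 * b * v) =
        exp (b * u) * exp (b * v) * (exp (b * (u - v)) + exp (- b * (u - v)))"
      by (simp add: distrib_left algebra_simps flip: exp_add)
    then show ?thesis by simp
  qed
  have "kdet n (\<lambda>i j. 1 / (exp (b * (x i - y j)) + exp (- b * (x i - y j)))) =
      (\<Prod>i<n. exp (b * x i)) * (\<Prod>j<n. exp (b * y j)) *
        kdet n (\<lambda>i j. 1 / (exp (2 * b * x i) + exp (2 * b * y j)))"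
    unfolding eq by (rule kdet_scale)
  also have "\<dots> > 0"
    using xy assms
    by (intro mult_pos_pos prod_pos kdet_cauchy_pos) (auto simp: strict_mono_on_def)
  finally show "kdet n (\<lambda>i j. 1 / (exp (b * (x i - y j)) + exp (- b * (x i - y j)))) > 0" .
qed

text \<open>
  The rows of \<open>v\<close> are turned into rows of its antiderivative one at a time, from the bottom:
  as a function of the sample point of that row, the determinant is monotone and vanishes where
  the row meets the next one (or at infinity).
\<close>

lemma totally_positive_antiderivative:
  fixes v w :: "real \<Rightarrow> real"
  assumes tp: "totally_positive v"
    and deriv: "\<And>z. (w has_real_derivative - v z) (at z)"
    and lim: "(w \<longlongrightarrow> 0) at_top"
  shows "totally_positive w"
proof -
  have "kdet n (\<lambda>i j. if i + m < n then v (s i - y j) else w (s i - y j)) > 0"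
    if "m \<le> n" "strict_mono_on {..<n} s" "strict_mono_on {..<n} y"
    for n m and s y :: "nat \<Rightarrow> real"
    using that
  proof (induction m arbitrary: s)
    case 0
    then have "kdet n (\<lambda>i j. v (s i - y j)) > 0"
      using tp unfolding totally_positive_iff by blast
    then show ?case
      by (subst kdet_cong[where B = "\<lambda>i j. v (s i - y j)"]) auto
  next
    case (Suc m)
    \<comment> \<open>Row \<open>k\<close> is the next one to be converted, and \<open>E z\<close>
      is the determinant after conversion with its sample point moved to \<open>z\<close>.\<close>
    define k where "k = n - Suc m"
    have k: "k < n" "\<And>i. i + Suc m < n \<longleftrightarrow> i < k" "\<And>i. i + m < n \<longleftrightarrow> i \<le> k"
      using Suc.prems(1) by (auto simp: k_def)
    define A where "A = (\<lambda>i j. if i < k then v (s i - y j) else w (s i - y j))"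
    obtain C where C: "\<And>r. kdet n (\<lambda>i j. if i = k then r j else A i j) = (\<Sum>j<n. r j * C j)"
      using kdet_row_linear[OF k(1)] by blast
    define E where "E = (\<lambda>z. \<Sum>j<n. w (z - y j) * C j)"
    have E_deriv: "(E has_real_derivative - (\<Sum>j<n. v (z - y j) * C j)) (at z)" for z
    proof -
      have "((\<lambda>z. w (z - y j)) has_real_derivative - v (z - y j)) (at z)" for j
        using DERIV_shift[of w "- v (z - y j)" z "- y j"] deriv by simp
      then show ?thesis
        unfolding E_def by (auto intro!: derivative_eq_intros simp: sum_negf)
    qed
    \<comment> \<open>The derivative of \<open>E\<close> at \<open>z\<close> is minus the
      determinant of the previous stage with \<open>s k\<close> replaced by \<open>z\<close>; the
      points stay increasing as long as \<open>z\<close> is below the next one.\<close>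
    have E_neg: "- (\<Sum>j<n. v (z - y j) * C j) < 0" if z: "s k \<le> z" "k + 1 < n \<Longrightarrow> z < s (k + 1)" for z
    proof -
      have "s i < z" if "i < k" for i
        using Suc.prems(2) that k(1) z(1)
        by (intro less_le_trans[OF _ z(1)]) (auto simp: strict_mono_on_def)
      moreover have "z < s i" if "i < n" "k < i" for i
      proof -
        have "s (k + 1) \<le> s i"
          using strict_mono_on_imp_mono_on[OF Suc.prems(2)] that by (auto simp: mono_on_def)
        then show ?thesis using z(2) that by linarith
      qed
      ultimately have sm: "strict_mono_on {..<n} (s(k := z))"
        using Suc.prems(2) by (auto simp: strict_mono_on_def)
      have "0 < kdet n (\<lambda>i j. if i + m < n then v ((s(k := z)) i - y j) else w ((s(k := z)) i - y j))"
        by (rule Suc.IH[OF _ sm Suc.prems(3)]) (use Suc.prems(1) in simp)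
      also have "\<dots> = kdet n (\<lambda>i j. if i = k then v (z - y j) else A i j)"
        by (rule kdet_cong) (auto simp: A_def k)
      finally show ?thesis unfolding C by simp
    qed
    have "E (s k) > 0"
    proof (cases "k + 1 < n")
      case True
      have "s k < s (k + 1)"
        using Suc.prems(2) True by (auto simp: strict_mono_on_def)
      then have "E (s (k + 1)) < E (s k)"
      proof (rule DERIV_neg_imp_decreasing_open)
        show "\<exists>d. DERIV E z :> d \<and> d < 0" if "s k < z" "z < s (k + 1)" for z
          using conjI[OF E_deriv E_neg[of z]] that by (metis less_imp_le)
        show "continuous_on {s k..s (k + 1)} E"
          by (intro continuous_at_imp_continuous_on ballI DERIV_isCont[OF E_deriv])
      qed
      moreover have "E (s (k + 1)) = 0"
        unfolding E_def C[symmetric]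
        by (rule kdet_identical_rows[of k _ "k + 1"]) (use True in \<open>auto simp: A_def\<close>)
      ultimately show ?thesis by simp
    next
      case False
      \<comment> \<open>The bottom row has no next row to meet. Here \<open>E\<close> decreases
        strictly to 0, so it is nonnegative at \<open>s k + 1\<close> and hence positive at
        \<open>s k\<close>.\<close>
      have dec: "E b < E a" if "s k \<le> a" "a < b" for a b
      proof (rule DERIV_neg_imp_decreasing[OF that(2)])
        show "\<exists>d. DERIV E z :> d \<and> d < 0" if "a \<le> z" for z
          using conjI[OF E_deriv E_neg[of z]] that \<open>s k \<le> a\<close> False by (metis order_trans)
      qed
      have "(E \<longlongrightarrow> (\<Sum>j<n. 0 * C j)) at_top"
        unfolding E_def
      proof (intro tendsto_sum tendsto_mult tendsto_const)
        fix j
        have "filterlim (\<lambda>z. z - y j) at_top at_top"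
          by real_asymp
        then show "((\<lambda>z. w (z - y j)) \<longlongrightarrow> 0) at_top"
          using lim by (rule filterlim_compose[rotated])
      qed
      moreover have "\<forall>\<^sub>F z in at_top. E z \<le> E (s k + 1)"
        using eventually_gt_at_top[of "s k + 1"]
        by eventually_elim (use dec[of "s k + 1"] in \<open>auto intro: less_imp_le\<close>)
      ultimately have "0 \<le> E (s k + 1)"
        using tendsto_upperbound[of E 0 at_top] by simp
      also have "\<dots> < E (s k)" by (rule dec) auto
      finally show ?thesis .
    qed
    also have "E (s k) = kdet n (\<lambda>i j. if i = k then w (s k - y j) else A i j)"
      unfolding E_def C ..
    also have "\<dots> = kdet n (\<lambda>i j. if i + Suc m < n then v (s i - y j) else w (s i - y j))"
      by (rule kdet_cong) (use k(2) in \<open>simp add: A_def del: add_Suc_right\<close>)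
    finally show ?case .
  qed
  from this[of n n for n] show ?thesis
    unfolding totally_positive_iff by simp
qed

section \<open>Convolution with one-sided exponentials\<close>

text \<open>The class contains \<open>kernel_seq\<close>, is closed under \<open>exp_tail a\<close>
  for \<open>a \<ge> 1\<close> up to doubling \<open>C\<close>, and consists of integrable
  functions; a common \<open>C\<close> supplies the domination for limits. The rate 1/2 stays below
  every such \<open>a\<close>, so that the tail integrals converge.\<close>

definition exp_bounded :: "real \<Rightarrow> (real \<Rightarrow> real) \<Rightarrow> bool" where
  "exp_bounded C g \<longleftrightarrow> continuous_on UNIV g \<and> (\<forall>x. 0 \<le> g x \<and> g x \<le> C * exp (- \<bar>x\<bar> / 2))"

text \<open>\<open>exp_tail a g\<close> solves \<open>a * h - h' = g\<close>, i.e. it is the convolution of \<open>g\<close> with a one-sided exponential.\<close>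

definition exp_tail :: "real \<Rightarrow> (real \<Rightarrow> real) \<Rightarrow> real \<Rightarrow> real" where
  "exp_tail a g x = exp (a * x) * integral {x..} (\<lambda>s. exp (- a * s) * g s)"

lemma exp_bounded_nonneg:
  assumes "exp_bounded C g"
  shows "C \<ge> 0"
proof -
  have "0 \<le> g 0" "g 0 \<le> C * exp (- \<bar>0\<bar> / 2)"
    using assms unfolding exp_bounded_def by blast+
  then show ?thesis by simp
qed

lemma exp_bounded_cmult:
  assumes "exp_bounded C g" "c \<ge> 0"
  shows "exp_bounded (c * C) (\<lambda>x. c * g x)"
  using assms by (auto simp: exp_bounded_def mult_left_mono mult.assoc intro!: continuous_intros)

lemma integrable_exp_bounded:
  assumes "exp_bounded C g"
  shows "integrable lebesgue g"
proof -
  have "(\<lambda>x::real. C * exp (- \<bar>x\<bar> / 2)) integrable_on UNIV"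
  proof -
    have right: "(\<lambda>x::real. exp (- \<bar>x\<bar> / 2)) integrable_on {0..}"
      using integrable_on_exp_minus_to_infinity[of "1 / 2" 0]
      by (rule integrable_eq) auto
    have left: "(\<lambda>x::real. exp (- \<bar>x\<bar> / 2)) integrable_on {..0}"
    proof -
      have "(\<lambda>x::real. exp (- (1 / 2) * x)) absolutely_integrable_on {0..}"
        using integrable_on_exp_minus_to_infinity[of "1 / 2" 0]
        by (intro nonnegative_absolutely_integrable_1) auto
      then have "(\<lambda>x::real. exp (1 / 2 * - x)) absolutely_integrable_on {0..}"
        by (simp only: minus_mult_commute)
      then have "(\<lambda>x::real. exp (1 / 2 * x)) absolutely_integrable_on {..0}"
        by (intro conjunct1[OF iffD1[OF has_absolute_integral_reflect_real[of "{0..}" "{..0}"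
            "\<lambda>x. exp (1 / 2 * x)" "integral {0..} (\<lambda>x. exp (1 / 2 * - x))"] conjI]]) auto
      then show ?thesis
        by (intro integrable_eq[OF set_lebesgue_integral_eq_integral(1)]) auto
    qed
    have "negligible ({..0} \<inter> {0..} :: real set)"
      by (rule negligible_subset[of "{0}"]) auto
    moreover have "{..0} \<union> {0..} = (UNIV :: real set)" by auto
    ultimately have "(\<lambda>x::real. exp (- \<bar>x\<bar> / 2)) integrable_on UNIV"
      using integrable_Un'[OF left right] by simp
    then show ?thesis by (rule integrable_on_mult_right)
  qed
  then have "g absolutely_integrable_on UNIV"
    using assms unfolding exp_bounded_def
    by (intro measurable_bounded_by_integrable_imp_absolutely_integrable)
       (auto intro!: continuous_imp_measurable_on_sets_lebesgue)
  then show ?thesis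
    by (simp add: set_integrable_def)
qed

context
  fixes a C :: real and g :: "real \<Rightarrow> real"
  assumes a: "a \<ge> 1" and g: "exp_bounded C g"
begin

text \<open>From \<open>\<bar>s\<bar> \<ge> \<bar>x\<bar> - (s - x)\<close>. In this form the
  dependence on \<open>s\<close> is a pure exponential, which integrates in closed form and returns
  the decay \<open>exp (- \<bar>x\<bar> / 2)\<close>.\<close>

lemma exp_tail_integrand_bound:
  assumes "x \<le> s"
  shows "exp (- a * s) * g s \<le> C * exp (- (\<bar>x\<bar> + x) / 2) * exp (- (a - 1 / 2) * s)"
proof -
  have "exp (- a * s) * g s \<le> exp (- a * s) * (C * exp (- \<bar>s\<bar> / 2))"
    using g by (auto simp: exp_bounded_def)
  also have "\<dots> = C * exp (- a * s - \<bar>s\<bar> / 2)"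
    by (simp only: diff_conv_add_uminus[of "- a * s"] exp_add) (simp add: mult_ac)
  also have "\<dots> \<le> C * exp (- (\<bar>x\<bar> + x) / 2 - (a - 1 / 2) * s)"
  proof (intro mult_left_mono exp_bounded_nonneg[OF g])
    have "- \<bar>s\<bar> \<le> s - x - \<bar>x\<bar>" using assms by linarith
    then show "exp (- a * s - \<bar>s\<bar> / 2) \<le> exp (- (\<bar>x\<bar> + x) / 2 - (a - 1 / 2) * s)"
      by (simp add: field_simps)
  qed
  also have "\<dots> = C * exp (- (\<bar>x\<bar> + x) / 2) * exp (- (a - 1 / 2) * s)"
    by (simp only: diff_conv_add_uminus[of "- (\<bar>x\<bar> + x) / 2"] exp_add mult.assoc mult_minus_left)
  finally show ?thesis .
qed

lemma exp_tail_integrand_nonneg: "0 \<le> exp (- a * s) * g s"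
  using g by (auto simp: exp_bounded_def)

lemma has_integral_exp_tail_bound:
  "((\<lambda>s. C * exp (- (\<bar>x\<bar> + x) / 2) * exp (- (a - 1 / 2) * s)) has_integral
      C * exp (- (\<bar>x\<bar> + x) / 2) * (exp (- (a - 1 / 2) * x) / (a - 1 / 2))) {x..}"
  using a by (intro has_integral_mult_right has_integral_exp_minus_to_infinity) auto

lemma exp_tail_integrable: "(\<lambda>s. exp (- a * s) * g s) integrable_on {x..}"
proof (rule measurable_bounded_by_integrable_imp_integrable_real)
  show "(\<lambda>s. exp (- a * s) * g s) \<in> borel_measurable (lebesgue_on {x..})"
    using g unfolding exp_bounded_def
    by (intro continuous_imp_measurable_on_sets_lebesgue continuous_intros)
       (auto intro: continuous_on_subset)
  show "(\<lambda>s. C * exp (- (\<bar>x\<bar> + x) / 2) * exp (- (a - 1 / 2) * s)) integrable_on {x..}"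
    using has_integral_exp_tail_bound by blast
qed (use exp_tail_integrand_bound exp_tail_integrand_nonneg in auto)

lemma exp_tail_integral_le:
  "integral {x..} (\<lambda>s. exp (- a * s) * g s) \<le> 2 * C * exp (- \<bar>x\<bar> / 2) * exp (- a * x)"
proof -
  have "integral {x..} (\<lambda>s. exp (- a * s) * g s) \<le>
      C * exp (- (\<bar>x\<bar> + x) / 2) * (exp (- (a - 1 / 2) * x) / (a - 1 / 2))"
    using exp_tail_integrable has_integral_exp_tail_bound exp_tail_integrand_bound
    by (intro has_integral_le[OF integrable_integral]) auto
  also have "\<dots> = C * (exp (- \<bar>x\<bar> / 2) * exp (- a * x)) / (a - 1 / 2)"
  proof -
    have "- (\<bar>x\<bar> + x) / 2 + - (a - 1 / 2) * x = - \<bar>x\<bar> / 2 + - a * x"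
      by (simp add: field_simps)
    then show ?thesis
      by (simp only: exp_add[symmetric] mult.assoc times_divide_eq_right)
  qed
  also have "\<dots> \<le> C * (exp (- \<bar>x\<bar> / 2) * exp (- a * x)) / (1 / 2)"
    using a exp_bounded_nonneg[OF g] by (intro divide_left_mono) auto
  finally show ?thesis by (simp add: mult_ac)
qed

lemma exp_tail_integral_deriv:
  "((\<lambda>x. integral {x..} (\<lambda>s. exp (- a * s) * g s)) has_real_derivative - (exp (- a * x) * g x)) (at x)"
proof -
  let ?h = "\<lambda>s. exp (- a * s) * g s"
  have cont: "continuous_on A ?h" for A
    using g unfolding exp_bounded_def by (auto intro!: continuous_intros intro: continuous_on_subset)
  \<comment> \<open>The fundamental theorem is applied on a compact interval around
    \<open>x\<close>, so the tail integral is split at the fixed base point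
    \<open>x - 1\<close>.\<close>
  have split: "integral {z..} ?h = integral {x - 1..} ?h - integral {x - 1..z} ?h"
    if "z \<in> {x - 1..x + 1}" for z
  proof -
    have "(?h has_integral (integral {x - 1..z} ?h + integral {z..} ?h)) ({x - 1..z} \<union> {z..})"
    proof (intro has_integral_Un integrable_integral integrable_continuous_interval
        exp_tail_integrable cont)
      show "negligible ({x - 1..z} \<inter> {z..})"
        by (rule negligible_subset[of "{z}"]) auto
    qed
    moreover have "{x - 1..z} \<union> {z..} = {x - 1..}" using that by auto
    ultimately have "(?h has_integral (integral {x - 1..z} ?h + integral {z..} ?h)) {x - 1..}"
      by (simp only:)
    from integral_unique[OF this] show ?thesis by linarith
  qed
  have "((\<lambda>z. integral {x - 1..z} ?h) has_real_derivative ?h x) (at x within {x - 1..x + 1})"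
    using cont by (intro integral_has_real_derivative) auto
  then have "((\<lambda>z. integral {x - 1..} ?h - integral {x - 1..z} ?h) has_real_derivative - ?h x)
      (at x within {x - 1..x + 1})"
    by (auto intro!: derivative_eq_intros)
  then have "((\<lambda>z. integral {z..} ?h) has_real_derivative - ?h x) (at x within {x - 1..x + 1})"
    by (rule has_field_derivative_transform_within[where d = 1, OF _ _ _ split[symmetric]]) simp_all
  moreover have "at x within {x - 1..x + 1} = at x"
    by (rule at_within_interior) simp
  ultimately show ?thesis by simp
qed

lemma exp_bounded_exp_tail: "exp_bounded (2 * C) (exp_tail a g)"
  unfolding exp_bounded_def
proof (intro conjI allI)
  have "continuous_on UNIV (\<lambda>x. integral {x..} (\<lambda>s. exp (- a * s) * g s))"
    by (intro continuous_at_imp_continuous_on ballI DERIV_isCont[OF exp_tail_integral_deriv])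
  then show "continuous_on UNIV (exp_tail a g)"
    unfolding exp_tail_def[abs_def] by (intro continuous_on_mult continuous_on_exp continuous_on_const continuous_on_id)
  fix x
  show "0 \<le> exp_tail a g x"
    unfolding exp_tail_def
    by (intro mult_nonneg_nonneg integral_nonneg exp_tail_integrable exp_tail_integrand_nonneg) auto
  have "exp_tail a g x \<le> exp (a * x) * (2 * C * exp (- \<bar>x\<bar> / 2) * exp (- a * x))"
    unfolding exp_tail_def by (intro mult_left_mono exp_tail_integral_le) auto
  also have "\<dots> = 2 * C * exp (- \<bar>x\<bar> / 2) * (exp (a * x) * exp (- a * x))"
    by (simp only: mult_ac)
  finally show "exp_tail a g x \<le> 2 * C * exp (- \<bar>x\<bar> / 2)"
    by (simp flip: exp_add)
qed

text \<open>\<open>exp_tail\<close> is a product with an exponential, followed by a decaying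
  antiderivative, followed by a product with an exponential; each of the three keeps total
  positivity.\<close>

lemma totally_positive_exp_tail:
  assumes "totally_positive g"
  shows "totally_positive (exp_tail a g)"
proof -
  let ?w = "\<lambda>x. integral {x..} (\<lambda>s. exp (- a * s) * g s)"
  have "totally_positive ?w"
  proof (rule totally_positive_antiderivative)
    show "totally_positive (\<lambda>s. exp (- a * s) * g s)"
      by (rule totally_positive_mult_exp[OF assms])
    show "(?w has_real_derivative - (exp (- a * z) * g z)) (at z)" for z
      by (rule exp_tail_integral_deriv)
    have "?w x \<le> 2 * C * 1 * exp (- a * x)" for x
      using exp_bounded_nonneg[OF g]
      by (intro order_trans[OF exp_tail_integral_le] mult_right_mono mult_left_mono) auto
    moreover have "0 \<le> ?w x" for x
      by (intro integral_nonneg exp_tail_integrable exp_tail_integrand_nonneg)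
    moreover have "((\<lambda>x. 2 * C * 1 * exp (- a * x)) \<longlongrightarrow> 0) at_top"
      using a by real_asymp
    ultimately show "(?w \<longlongrightarrow> 0) at_top"
      by (intro real_tendsto_sandwich[of "\<lambda>_. 0" ?w at_top "\<lambda>x. 2 * C * 1 * exp (- a * x)"]) auto
  qed
  then show ?thesis
    unfolding exp_tail_def by (rule totally_positive_mult_exp)
qed

end

lemma exp_tail_tendsto:
  assumes a: "a \<ge> 1" and g: "\<And>n::nat. exp_bounded C (g n)"
    and lim: "\<And>s. (\<lambda>n. g n s) \<longlonglongrightarrow> g' s"
    and I: "((\<lambda>s. exp (- a * s) * g' s) has_integral I) {x..}"
  shows "(\<lambda>n. exp_tail a (g n) x) \<longlonglongrightarrow> exp (a * x) * I"
proof -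
  have "(\<lambda>n. integral {x..} (\<lambda>s. exp (- a * s) * g n s)) \<longlonglongrightarrow> integral {x..} (\<lambda>s. exp (- a * s) * g' s)"
  proof (rule dominated_convergence(2))
    show "(\<lambda>s. exp (- a * s) * g n s) integrable_on {x..}" for n
      by (rule exp_tail_integrable[OF a g])
    show "(\<lambda>s. C * exp (- (\<bar>x\<bar> + x) / 2) * exp (- (a - 1 / 2) * s)) integrable_on {x..}"
      using has_integral_exp_tail_bound[OF a g] by blast
    show "norm (exp (- a * s) * g n s) \<le> C * exp (- (\<bar>x\<bar> + x) / 2) * exp (- (a - 1 / 2) * s)"
      if "s \<in> {x..}" for n s
      using exp_tail_integrand_bound[OF a g, of x s n] exp_tail_integrand_nonneg[OF a g, of s n] that
      by simp
    show "(\<lambda>n. exp (- a * s) * g n s) \<longlonglongrightarrow> exp (- a * s) * g' s" for s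
      by (intro tendsto_intros lim)
  qed
  then show ?thesis
    unfolding exp_tail_def integral_unique[OF I] by (intro tendsto_intros)
qed

text \<open>
  \<open>kernel_seq\<close> approximates a one-sided exponential, so \<open>laplace_seq\<close> approximates
  \<open>exp (- \<bar>x\<bar>)\<close> and \<open>two_pole_seq\<close> the convolution of the latter with a one-sided exponential
  of rate 3. The shift \<open>+ 2\<close> makes \<open>kernel_seq 0\<close> integrable.
\<close>

definition kernel_seq :: "nat \<Rightarrow> real \<Rightarrow> real" where
  "kernel_seq n x = exp (- x) / (1 + exp (- (real n + 2) * x))"

definition laplace_seq :: "nat \<Rightarrow> real \<Rightarrow> real" where
  "laplace_seq n x = 2 * exp_tail 1 (kernel_seq n) x"

text \<open>The bounded solution of \<open>3 * h - h' = 4 * exp (- \<bar>x\<bar>)\<close>. The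
  branches agree at 0 in value and first derivative, but not in the second derivative.\<close>

definition two_pole :: "real \<Rightarrow> real" where
  "two_pole x = (if x \<ge> 0 then exp (- x) else 2 * exp x - exp (3 * x))"

definition two_pole_seq :: "nat \<Rightarrow> real \<Rightarrow> real" where
  "two_pole_seq n x = 4 * exp_tail 3 (laplace_seq n) x"

lemma exp_bounded_kernel_seq: "exp_bounded 1 (kernel_seq n)"
proof -
  have "kernel_seq n x \<le> exp (- \<bar>x\<bar> / 2)" for x
  proof (cases "x \<ge> 0")
    case True
    have "kernel_seq n x \<le> exp (- x) / 1"
      unfolding kernel_seq_def by (intro divide_left_mono) (auto intro: add_pos_pos)
    also have "\<dots> \<le> exp (- \<bar>x\<bar> / 2)" using True by simp
    finally show ?thesis .
  next
    case False
    have "kernel_seq n x \<le> exp (- x) / exp (- (real n + 2) * x)"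
      unfolding kernel_seq_def by (intro divide_left_mono mult_pos_pos add_pos_pos) auto
    also have "\<dots> = exp ((real n + 1) * x)"
      by (simp add: algebra_simps flip: exp_diff)
    also have "(real n + 1) * x \<le> - \<bar>x\<bar> / 2"
      using mult_nonneg_nonpos[of "real n" x] False by (simp add: algebra_simps)
    finally show ?thesis by simp
  qed
  moreover have "1 + exp (- (real n + 2) * x) \<noteq> 0" for x
    using exp_gt_zero[of "- (real n + 2) * x"] by linarith
  then have "continuous_on UNIV (kernel_seq n)"
    unfolding kernel_seq_def[abs_def] by (intro continuous_intros) auto
  moreover have "0 \<le> kernel_seq n x" for x
    unfolding kernel_seq_def by (intro divide_nonneg_nonneg add_nonneg_nonneg) auto
  ultimately show ?thesis
    unfolding exp_bounded_def by simp
qed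

text \<open>Taking half of the exponent out of the denominator shows \<open>kernel_seq\<close> to be
  an exponential times a hyperbolic secant.\<close>

lemma totally_positive_kernel_seq: "totally_positive (kernel_seq n)"
proof -
  have "kernel_seq n = (\<lambda>x. exp (real n / 2 * x) *
      (1 / (exp ((real n + 2) / 2 * x) + exp (- ((real n + 2) / 2) * x))))"
  proof
    fix x
    have "exp ((real n + 2) / 2 * x) + exp (- ((real n + 2) / 2) * x) =
        exp ((real n + 2) / 2 * x) * (1 + exp (- (real n + 2) * x))"
      by (simp add: distrib_left flip: exp_add) (simp add: field_simps)
    moreover have "exp (real n / 2 * x) = exp ((real n + 2) / 2 * x) * exp (- x)"
      by (simp flip: exp_add) (simp add: field_simps)
    ultimately show "kernel_seq n x = exp (real n / 2 * x) *
      (1 / (exp ((real n + 2) / 2 * x) + exp (- ((real n + 2) / 2) * x)))"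
      by (simp add: kernel_seq_def)
  qed
  then show ?thesis
    using totally_positive_mult_exp[OF totally_positive_sech[of "(real n + 2) / 2"], of "real n / 2"]
    by simp
qed

lemma exp_bounded_laplace_seq: "exp_bounded 4 (laplace_seq n)"
  unfolding laplace_seq_def[abs_def]
  using exp_bounded_cmult[OF exp_bounded_exp_tail[OF _ exp_bounded_kernel_seq], of 1 2] by simp

lemma totally_positive_laplace_seq: "totally_positive (laplace_seq n)"
  unfolding laplace_seq_def[abs_def]
  by (intro totally_positive_cmult totally_positive_exp_tail[OF _ exp_bounded_kernel_seq]
      totally_positive_kernel_seq) auto

lemma exp_bounded_two_pole_seq: "exp_bounded 32 (two_pole_seq n)"
  unfolding two_pole_seq_def[abs_def]
  using exp_bounded_cmult[OF exp_bounded_exp_tail[OF _ exp_bounded_laplace_seq], of 3 4] by simp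

lemma totally_positive_two_pole_seq: "totally_positive (two_pole_seq n)"
  unfolding two_pole_seq_def[abs_def]
  by (intro totally_positive_cmult totally_positive_exp_tail[OF _ exp_bounded_laplace_seq]
      totally_positive_laplace_seq) auto

lemma kernel_seq_tendsto:
  "(\<lambda>n. kernel_seq n x) \<longlonglongrightarrow> (if x > 0 then exp (- x) else if x = 0 then 1 / 2 else 0)"
proof -
  consider "x > 0" | "x = 0" | "x < 0" by linarith
  then show ?thesis
    unfolding kernel_seq_def by cases (simp_all, real_asymp+)
qed

lemma laplace_seq_tendsto: "(\<lambda>n. laplace_seq n x) \<longlonglongrightarrow> exp (- \<bar>x\<bar>)"
proof -
  let ?g = "\<lambda>x::real. if x > 0 then exp (- x) else if x = 0 then 1 / 2 else 0"
  \<comment> \<open>The limit kernel vanishes on the negative axis, so the integral from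
    \<open>x\<close> effectively starts at \<open>max x 0\<close>; its value 1/2 at 0 is removed as
    a null set.\<close>
  have "((\<lambda>s. exp (- 2 * s)) has_integral exp (- 2 * max x 0) / 2) {max x 0..}"
    by (rule has_integral_exp_minus_to_infinity) auto
  then have "((\<lambda>s. if s \<in> {max x 0..} then exp (- 2 * s) else 0) has_integral
      exp (- 2 * max x 0) / 2) {x..}"
    by (subst has_integral_restrict) auto
  then have "((\<lambda>s. exp (- 1 * s) * ?g s) has_integral exp (- 2 * max x 0) / 2) {x..}"
    by (rule has_integral_spike[of "{0}", rotated 2]) (auto simp flip: exp_add)
  from exp_tail_tendsto[OF _ exp_bounded_kernel_seq kernel_seq_tendsto this]
  have "(\<lambda>n. exp_tail 1 (kernel_seq n) x) \<longlonglongrightarrow> exp (1 * x) * (exp (- 2 * max x 0) / 2)"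
    by simp
  then have "(\<lambda>n. laplace_seq n x) \<longlonglongrightarrow> 2 * (exp (1 * x) * (exp (- 2 * max x 0) / 2))"
    unfolding laplace_seq_def by (intro tendsto_intros)
  also have "2 * (exp (1 * x) * (exp (- 2 * max x 0) / 2)) = exp (- \<bar>x\<bar>)"
    by (simp add: max_def flip: exp_add)
  finally show ?thesis .
qed

lemma two_pole_seq_tendsto: "(\<lambda>n. two_pole_seq n x) \<longlonglongrightarrow> two_pole x"
proof -
  define I where "I = (if x \<ge> 0 then exp (- 4 * x) / 4 else (exp (- 2 * x) - 1) / 2 + 1 / 4)"
  have right: "((\<lambda>s. exp (- 3 * s) * exp (- \<bar>s\<bar>)) has_integral exp (- 4 * c) / 4) {c..}"
    if "c \<ge> 0" for c :: real
  proof -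
    have "((\<lambda>s. exp (- 4 * s)) has_integral exp (- 4 * c) / 4) {c..}"
      by (rule has_integral_exp_minus_to_infinity) auto
    then show ?thesis
      by (rule has_integral_eq[rotated]) (use that in \<open>auto simp flip: exp_add\<close>)
  qed
  have "((\<lambda>s. exp (- 3 * s) * exp (- \<bar>s\<bar>)) has_integral I) {x..}"
  proof (cases "x \<ge> 0")
    case True
    then show ?thesis using right[of x] by (simp add: I_def)
  next
    case False
    have "((\<lambda>s. exp (- 2 * s)) has_integral (- exp (- 2 * 0) / 2 - (- exp (- 2 * x) / 2))) {x..0}"
      using False by (intro fundamental_theorem_of_calculus)
        (auto intro!: derivative_eq_intros simp flip: has_real_derivative_iff_has_vector_derivative)
    then have "((\<lambda>s. exp (- 2 * s)) has_integral (exp (- 2 * x) - 1) / 2) {x..0}"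
      by (simp add: diff_divide_distrib)
    then have "((\<lambda>s. exp (- 3 * s) * exp (- \<bar>s\<bar>)) has_integral (exp (- 2 * x) - 1) / 2) {x..0}"
      by (rule has_integral_eq[rotated]) (auto simp flip: exp_add)
    moreover have "((\<lambda>s::real. exp (- 3 * s) * exp (- \<bar>s\<bar>)) has_integral 1 / 4) {0..}"
      using right[of 0] by simp
    moreover have "negligible ({x..0} \<inter> {0..})"
      by (rule negligible_subset[of "{0}"]) auto
    ultimately have "((\<lambda>s. exp (- 3 * s) * exp (- \<bar>s\<bar>)) has_integral ((exp (- 2 * x) - 1) / 2 + 1 / 4))
        ({x..0} \<union> {0..})"
      by (rule has_integral_Un)
    moreover have "{x..0} \<union> {0..} = {x..}" using False by auto
    ultimately show ?thesis using False by (simp only: I_def if_False)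
  qed
  from exp_tail_tendsto[OF _ exp_bounded_laplace_seq laplace_seq_tendsto this]
  have "(\<lambda>n. two_pole_seq n x) \<longlonglongrightarrow> 4 * (exp (3 * x) * I)"
    unfolding two_pole_seq_def by (intro tendsto_intros) auto
  also have "4 * (exp (3 * x) * I) = two_pole x"
    by (simp add: I_def two_pole_def algebra_simps diff_divide_distrib flip: exp_add)
  finally show ?thesis .
qed

lemma two_pole_pos: "two_pole x > 0"
proof (cases "x \<ge> 0")
  case False
  have "exp (3 * x) < exp x" "exp x < 2 * exp x" using False by auto
  then have "exp (3 * x) < 2 * exp x" by (rule less_trans)
  then show ?thesis using False by (simp add: two_pole_def)
qed (simp add: two_pole_def)

lemma continuous_two_pole: "continuous_on UNIV two_pole"
proof -
  have "continuous_on ({0..} \<union> {..0}) (\<lambda>x::real. if x \<ge> 0 then exp (- x) else 2 * exp x - exp (3 * x))"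
    by (intro continuous_on_If) (auto intro!: continuous_intros)
  moreover have "{0..} \<union> {..0} = (UNIV :: real set)" by auto
  ultimately show ?thesis unfolding two_pole_def[abs_def] by simp
qed

section \<open>Continuity\<close>

lemma integrable_dilate:
  fixes g :: "real \<Rightarrow> real"
  assumes "exp_bounded C g" "m \<noteq> 0"
  shows "integrable lebesgue (\<lambda>x. g (m * x))"
proof -
  have g: "continuous_on UNIV g"
    using assms(1) by (simp add: exp_bounded_def)
  then have [measurable]: "g \<in> borel_measurable borel"
    by (rule borel_measurable_continuous_onI)
  have "integrable lborel g"
    using integrable_exp_bounded[OF assms(1)] by (subst (asm) integrable_completion) auto
  then have "integrable lborel (\<lambda>x. g (0 + m * x))"
    using assms(2) by (rule lborel_integrable_real_affine)
  then show ?thesis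
    by (subst integrable_completion) auto
qed

lemma floor_scaled_tendsto: "(\<lambda>M. real_of_int \<lfloor>real M * x\<rfloor> / real M) \<longlonglongrightarrow> x"
proof (rule real_tendsto_sandwich)
  have "real_of_int \<lfloor>real M * x\<rfloor> / real M \<le> x \<and> x - 1 / real M \<le> real_of_int \<lfloor>real M * x\<rfloor> / real M"
    if "M > 0" for M
  proof -
    have "real_of_int \<lfloor>real M * x\<rfloor> / real M \<le> real M * x / real M"
      by (intro divide_right_mono) auto
    moreover have "(real M * x - 1) / real M \<le> real_of_int \<lfloor>real M * x\<rfloor> / real M"
      by (intro divide_right_mono) linarith+
    ultimately show ?thesis using that by (simp add: diff_divide_distrib)
  qed
  then show "\<forall>\<^sub>F M in sequentially. x - 1 / real M \<le> real_of_int \<lfloor>real M * x\<rfloor> / real M"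
      "\<forall>\<^sub>F M in sequentially. real_of_int \<lfloor>real M * x\<rfloor> / real M \<le> x"
    by (auto intro!: eventually_sequentiallyI[of 1])
  show "(\<lambda>M. x - 1 / real M) \<longlonglongrightarrow> x" "(\<lambda>M. x) \<longlonglongrightarrow> x"
    by real_asymp+
qed

text \<open>Once \<open>M\<close> times every gap exceeds 1, the floors are distinct. Real
  configurations are thus limits of increasing ones on the grids of mesh
  \<open>1 / M\<close>.\<close>

lemma eventually_floor_strict_mono:
  assumes "strict_mono_on {..<n} x"
  shows "\<forall>\<^sub>F M in sequentially. strict_mono_on {..<n} (\<lambda>i::nat. \<lfloor>real M * x i\<rfloor>)"
proof -
  have "\<forall>\<^sub>F M in sequentially. \<lfloor>real M * x i\<rfloor> < \<lfloor>real M * x j\<rfloor>" if "i < j" "j < n" for i j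
  proof -
    have "x i < x j" using assms that by (auto simp: strict_mono_on_def)
    then have "\<forall>\<^sub>F M in sequentially. real M * (x j - x i) > 1"
      by real_asymp
    then show ?thesis
    proof eventually_elim
      case (elim M)
      then have "real M * x i + 1 \<le> real M * x j" by (simp add: algebra_simps)
      then have "\<lfloor>real M * x i + 1\<rfloor> \<le> \<lfloor>real M * x j\<rfloor>" by (rule floor_mono)
      then show ?case by simp
    qed
  qed
  then have "\<forall>\<^sub>F M in sequentially. \<forall>p\<in>{(i, j). i < j \<and> j < n}.
      \<lfloor>real M * x (fst p)\<rfloor> < \<lfloor>real M * x (snd p)\<rfloor>"
    by (intro eventually_ball_finite finite_subset[of "{(i, j). i < j \<and> j < n}" "{..<n} \<times> {..<n}"]) auto
  then show ?thesis
    by eventually_elim (auto simp: strict_mono_on_def)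
qed

section \<open>Monotonicity and continuity of \<open>F\<close>\<close>

locale TP_preserver =
  fixes F :: "real \<Rightarrow> real"
  assumes pos: "\<And>x. x > 0 \<Longrightarrow> F x > 0"
    and preserves: "\<And>\<Lambda>. totally_positive \<Lambda> \<Longrightarrow> integrable lebesgue \<Lambda> \<Longrightarrow>
      totally_positive (\<lambda>k::int. F (\<Lambda> (real_of_int k)))"
begin

text \<open>This is the \<open>2 \<times> 2\<close> minor at the integers 0 and 1 for the kernel
  \<open>c * exp (\<gamma> * x) / cosh (\<beta> * x)\<close>, which is integrable because
  \<open>\<bar>\<gamma>\<bar> < \<beta>\<close>.\<close>

lemma sech_ineq:
  assumes "c > 0" "\<bar>\<gamma>\<bar> < \<beta>"
  shows "F (c * exp \<gamma> / cosh \<beta>) * F (c * exp (- \<gamma>) / cosh \<beta>) < (F c)\<^sup>2"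
proof -
  \<comment> \<open>Dividing the rates by their difference \<open>m\<close> gives \<open>g\<close>
    the decay \<open>exp (- \<bar>x\<bar>)\<close>, enough for \<open>exp_bounded\<close>;
    \<open>\<Lambda>\<close> undoes the scaling, and its factor 2 compensates
    \<open>g 0 = 1 / 2\<close>.\<close>
  define m where "m = \<beta> - \<bar>\<gamma>\<bar>"
  define g where "g = (\<lambda>x. exp (\<gamma> / m * x) * (1 / (exp (\<beta> / m * x) + exp (- (\<beta> / m) * x))))"
  have m: "m > 0" and \<beta>: "\<beta> > 0" using assms by (auto simp: m_def)
  have tp: "totally_positive g"
    unfolding g_def using m \<beta> by (intro totally_positive_mult_exp totally_positive_sech) auto
  have nz: "exp (\<beta> / m * x) + exp (- (\<beta> / m) * x) \<noteq> 0" for x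
    by (metis add_pos_pos exp_gt_zero less_irrefl)
  have "g x \<le> exp (- \<bar>x\<bar> / 2)" for x
  proof -
    have "\<beta> / m * \<bar>x\<bar> = \<bar>\<gamma>\<bar> / m * \<bar>x\<bar> + \<bar>x\<bar>"
      using m by (simp add: m_def field_simps)
    moreover have "\<gamma> / m * x \<le> \<bar>\<gamma> / m * x\<bar>"
      by (rule abs_ge_self)
    then have "\<gamma> / m * x \<le> \<bar>\<gamma>\<bar> / m * \<bar>x\<bar>"
      using m by (simp add: abs_mult)
    ultimately have "\<gamma> / m * x - \<beta> / m * \<bar>x\<bar> \<le> - \<bar>x\<bar> / 2"
      by linarith
    moreover have "exp (\<beta> / m * \<bar>x\<bar>) \<le> exp (\<beta> / m * x) + exp (- (\<beta> / m) * x)"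
      by (cases "x \<ge> 0") auto
    then have "g x \<le> exp (\<gamma> / m * x) * (1 / exp (\<beta> / m * \<bar>x\<bar>))"
      unfolding g_def by (intro mult_left_mono divide_left_mono mult_pos_pos add_pos_pos) auto
    then have "g x \<le> exp (\<gamma> / m * x - \<beta> / m * \<bar>x\<bar>)"
      by (simp add: exp_diff)
    ultimately show ?thesis
      by (meson exp_le_cancel_iff order_trans)
  qed
  moreover have "continuous_on UNIV g"
    unfolding g_def using nz by (intro continuous_intros) auto
  ultimately have g: "exp_bounded 1 g"
    using totally_positive_imp_pos[OF tp] by (auto simp: exp_bounded_def intro: less_imp_le)
  define \<Lambda> where "\<Lambda> = (\<lambda>x. 2 * c * g (m * x))"
  have "totally_positive \<Lambda>"
    unfolding \<Lambda>_def using tp m assms by (intro totally_positive_cmult totally_positive_dilate) auto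
  moreover have "integrable lebesgue \<Lambda>"
    unfolding \<Lambda>_def using integrable_dilate[OF g] m by simp
  ultimately have "totally_positive (\<lambda>k::int. F (\<Lambda> (real_of_int k)))"
    by (rule preserves)
  then have "kdet 2 (\<lambda>i j. F (\<Lambda> (real_of_int (int i - int j)))) > 0"
    by (rule totally_positive_iff[THEN iffD1, rule_format]) (auto simp: strict_mono_on_def)
  then have "F (\<Lambda> 1) * F (\<Lambda> (- 1)) < (F (\<Lambda> 0))\<^sup>2"
    by (simp add: kdet_2 power2_eq_square mult.commute)
  moreover have "\<Lambda> 0 = c" "\<Lambda> 1 = c * exp \<gamma> / cosh \<beta>" "\<Lambda> (- 1) = c * exp (- \<gamma>) / cosh \<beta>"
    using m by (auto simp: \<Lambda>_def g_def cosh_def field_simps)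
  ultimately show ?thesis by simp
qed

text \<open>Take \<open>\<gamma> = 0\<close> and \<open>cosh \<beta> = v / u\<close> in
  \<open>sech_ineq\<close>: the centre is \<open>v\<close> and both neighbours are
  \<open>u\<close>.\<close>

lemma strict_mono_pos:
  assumes "0 < u" "u < v"
  shows "F u < F v"
proof -
  have "cosh (arcosh (v / u)) = v / u" "arcosh (v / u) > 0"
    using assms by (auto intro: arcosh_real_gt_1_iff)
  then have "F (v * exp 0 / (v / u)) * F (v * exp (- 0) / (v / u)) < (F v)\<^sup>2"
    using sech_ineq[of v 0 "arcosh (v / u)"] assms by simp
  then have "(F u)\<^sup>2 < (F v)\<^sup>2"
    using assms by (simp add: power2_eq_square)
  then show ?thesis
    using pos[of v] assms by (simp add: power_less_imp_less_base less_imp_le)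
qed

lemma mono_pos: "0 < u \<Longrightarrow> u \<le> v \<Longrightarrow> F u \<le> F v"
  using strict_mono_pos[of u v] by (cases "u = v") auto

text \<open>To first order \<open>exp h / cosh (2 * h)\<close> is \<open>1 + h\<close>, so with
  \<open>\<gamma> = h\<close> and \<open>\<beta> = 2 * h\<close> the right neighbour in
  \<open>sech_ineq\<close> exceeds the centre. The two bounds on \<open>x\<close> concern the left
  neighbour, when the right neighbour is \<open>v\<close> and when the centre is
  \<open>v\<close>.\<close>

lemma small_window:
  fixes x v :: real
  assumes "0 < x" "x < v"
  obtains h where "h > 0" "exp h / cosh (2 * h) > 1" "x < v * exp (- 2 * h)" "x < v * exp (- h) / cosh (2 * h)"
proof -
  have "\<forall>\<^sub>F h in at_right 0. exp h > (exp (2 * h) + exp (- (2 * h))) / (2::real)"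
    by real_asymp
  moreover have "((\<lambda>h. v * exp (- 2 * h)) \<longlongrightarrow> v) (at_right 0)"
    by real_asymp
  then have "\<forall>\<^sub>F h in at_right 0. x < v * exp (- 2 * h)"
    using assms(2) by (rule order_tendstoD)
  moreover have "((\<lambda>h. v * exp (- h) / ((exp (2 * h) + exp (- (2 * h))) / 2)) \<longlongrightarrow> v) (at_right 0)"
    by real_asymp
  then have "\<forall>\<^sub>F h in at_right 0. x < v * exp (- h) / ((exp (2 * h) + exp (- (2 * h))) / 2)"
    using assms(2) by (rule order_tendstoD)
  moreover have "\<forall>\<^sub>F h in at_right (0::real). h > 0"
    by (rule eventually_at_right_less)
  ultimately have "\<forall>\<^sub>F h in at_right (0::real). h > 0 \<and> exp h / cosh (2 * h) > 1 \<and>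
      x < v * exp (- 2 * h) \<and> x < v * exp (- h) / cosh (2 * h)"
    by eventually_elim (simp add: cosh_def add_pos_pos field_simps)
  then obtain h where "h > 0" "exp h / cosh (2 * h) > 1"
      "x < v * exp (- 2 * h)" "x < v * exp (- h) / cosh (2 * h)"
    by (metis (mono_tags, lifting) eventually_happens trivial_limit_at_right_real)
  then show ?thesis by (rule that)
qed

text \<open>
  If \<open>F\<close> jumped up to \<open>v\<close> from the left, centre \<open>sech_ineq\<close> slightly below \<open>v\<close>, so that its
  right neighbour is \<open>v\<close> itself while centre and left neighbour stay below.
\<close>

lemma no_jump_left:
  assumes v: "v > 0" and K: "K < F v"
  shows "\<exists>x. 0 < x \<and> x < v \<and> K < F x"
proof (rule ccontr)
  assume "\<not> ?thesis"
  then have K': "F x \<le> K" if "0 < x" "x < v" for x using that by force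
  define L where "L = Sup (F ` {0<..<v})"
  have ne: "{0<..<v} \<noteq> {}" using v by auto
  have bdd: "bdd_above (F ` {0<..<v})" using K' by (intro bdd_aboveI[of _ K]) auto
  have le: "F x \<le> L" if "0 < x" "x < v" for x
    unfolding L_def using that by (intro cSUP_upper bdd) auto
  have "L \<le> K" unfolding L_def using K' ne by (intro cSUP_least) auto
  then have L: "L < F v" using K by simp
  have "F (v / 2) \<le> L" using v by (intro le) auto
  then have L0: "L > 0" using pos[of "v / 2"] v by simp
  \<comment> \<open>\<open>L\<close> is the left limit of \<open>F\<close> at \<open>v\<close>. As
    it lies below \<open>F v\<close>, some \<open>x\<close> left of \<open>v\<close> has
    \<open>F v * F x\<close> above the square of \<open>L\<close>, which the sech inequality will
    contradict.\<close>
  have "L * (L / F v) < L * 1"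
    using L L0 pos[OF v] by (intro mult_strict_left_mono) auto
  then obtain x where x: "0 < x" "x < v" "L * (L / F v) < F x"
    using less_cSUP_iff[OF ne bdd] unfolding L_def by auto
  obtain h where h: "h > 0" "exp h / cosh (2 * h) > 1" "x < v * exp (- 2 * h)"
    using small_window[OF x(1,2)] by metis
  define c where "c = v / (exp h / cosh (2 * h))"
  have c: "0 < c" "c < v" using h v by (auto simp: c_def divide_less_eq)
  have "c * exp h / cosh (2 * h) = v" "c * exp (- h) / cosh (2 * h) = v * exp (- 2 * h)"
    by (auto simp: c_def exp_minus field_simps simp flip: exp_add)
  then have "F v * F (v * exp (- 2 * h)) < (F c)\<^sup>2"
    using sech_ineq[of c h "2 * h"] h c by simp
  also have "\<dots> \<le> L\<^sup>2"
    using le[of c] c pos[of c] by (intro power_mono) auto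
  finally have "F v * F (v * exp (- 2 * h)) < L\<^sup>2" .
  moreover have "F v * F x < F v * F (v * exp (- 2 * h))"
    using strict_mono_pos[OF x(1) h(3)] pos[OF v] by simp
  moreover have "L\<^sup>2 < F v * F x"
    using x(3) pos[OF v] by (simp add: field_simps power2_eq_square)
  ultimately show False by simp
qed

text \<open>Centre \<open>sech_ineq\<close> at \<open>v\<close>. The right neighbour exceeds
  \<open>v\<close>, so a jump gives it a value of at least \<open>K\<close>, while
  \<open>no_jump_left\<close> keeps the value at the left neighbour close enough to
  \<open>F v\<close> to break the inequality.\<close>

lemma no_jump_right:
  assumes v: "v > 0" and K: "F v < K"
  shows "\<exists>x>v. F x < K"
proof (rule ccontr)
  assume "\<not> ?thesis"
  then have K': "K \<le> F x" if "v < x" for x using that by force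
  have K0: "K > 0" using K pos[OF v] by simp
  have "F v * (F v / K) < F v * 1"
    using K K0 pos[OF v] by (intro mult_strict_left_mono) auto
  then obtain x where x: "0 < x" "x < v" "F v * (F v / K) < F x"
    using no_jump_left[OF v] by auto
  obtain h where h: "h > 0" "exp h / cosh (2 * h) > 1" "x < v * exp (- h) / cosh (2 * h)"
    using small_window[OF x(1,2)] by metis
  have "v * 1 < v * (exp h / cosh (2 * h))" using h(2) v by (intro mult_strict_left_mono)
  then have "K \<le> F (v * exp h / cosh (2 * h))" by (intro K') simp
  then have "K * F x < F (v * exp h / cosh (2 * h)) * F (v * exp (- h) / cosh (2 * h))"
    using strict_mono_pos[OF x(1) h(3)] pos[OF x(1)] K0 by (intro mult_le_less_imp_less) auto
  also have "\<dots> < (F v)\<^sup>2"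
    using sech_ineq[of v h "2 * h"] h v by simp
  finally show False
    using x(3) K0 by (simp add: field_simps power2_eq_square)
qed

lemma continuous_pos:
  assumes v: "v > 0"
  shows "isCont F v"
  unfolding isCont_def
proof (rule order_tendstoI)
  fix K assume "K < F v"
  then obtain x where x: "0 < x" "x < v" "K < F x" using no_jump_left[OF v] by blast
  have "\<forall>\<^sub>F z in at v. x < z"
    using x(2) by (intro order_tendstoD(1)[OF tendsto_ident_at])
  then show "\<forall>\<^sub>F z in at v. K < F z"
    by eventually_elim (use x mono_pos in \<open>auto intro: less_le_trans less_imp_le\<close>)
next
  fix K assume "F v < K"
  then obtain x where x: "v < x" "F x < K" using no_jump_right[OF v] by blast
  have "\<forall>\<^sub>F z in at v. z < x"
    using x(1) by (intro order_tendstoD(2)[OF tendsto_ident_at])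
  moreover have "\<forall>\<^sub>F z in at v. 0 < z"
    using v by (intro order_tendstoD(1)[OF tendsto_ident_at])
  ultimately show "\<forall>\<^sub>F z in at v. F z < K"
    by eventually_elim (use x mono_pos in \<open>auto intro: le_less_trans less_imp_le\<close>)
qed

text \<open>Two limits in turn: first in the kernel, on a grid of mesh \<open>1 / M\<close> that a
  dilation carries to the integers, then in the mesh. Strict positivity does not survive
  them.\<close>

lemma limit_kernel_minor_nonneg:
  assumes S: "\<And>k::nat. totally_positive (S k)" "\<And>k. exp_bounded C (S k)"
    and lim: "\<And>z. (\<lambda>k. S k z) \<longlonglongrightarrow> T z"
    and T: "continuous_on UNIV T" "\<And>z. T z > 0"
    and L: "L > 0" and xy: "strict_mono_on {..<n} x" "strict_mono_on {..<n} y"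
  shows "kdet n (\<lambda>i j. F (L * T (x i - y j))) \<ge> 0"
proof -
  have F: "((\<lambda>t. F (f t)) \<longlongrightarrow> F l) G" if "(f \<longlongrightarrow> l) G" "l > 0" for f l and G :: "nat filter"
    using continuous_pos[OF that(2)] that(1) by (rule isCont_tendsto_compose)
  have int: "kdet n (\<lambda>i j. F (L * T (1 / real M * real_of_int (x' i - y' j)))) \<ge> 0"
    if "M > 0" and xy': "strict_mono_on {..<n} x'" "strict_mono_on {..<n} y'"
    for M and x' y' :: "nat \<Rightarrow> int"
  proof (rule tendsto_lowerbound)
    show "(\<lambda>k. kdet n (\<lambda>i j. F (L * S k (1 / real M * real_of_int (x' i - y' j)))))
        \<longlonglongrightarrow> kdet n (\<lambda>i j. F (L * T (1 / real M * real_of_int (x' i - y' j))))"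
      using T L by (intro tendsto_kdet F tendsto_mult tendsto_const lim) auto
    have "totally_positive (\<lambda>z. L * S k (1 / real M * z))" for k
      using S L \<open>M > 0\<close> by (intro totally_positive_cmult totally_positive_dilate) auto
    moreover have "integrable lebesgue (\<lambda>z. L * S k (1 / real M * z))" for k
      using integrable_dilate[OF S(2), of "1 / real M"] \<open>M > 0\<close> by simp
    ultimately have "totally_positive (\<lambda>z::int. F (L * S k (1 / real M * real_of_int z)))" for k
      by (rule preserves)
    then have "kdet n (\<lambda>i j. F (L * S k (1 / real M * real_of_int (x' i - y' j)))) > 0" for k
      using xy' unfolding totally_positive_iff by blast
    then show "\<forall>\<^sub>F k in sequentially. 0 \<le> kdet n (\<lambda>i j. F (L * S k (1 / real M * real_of_int (x' i - y' j))))"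
      by (intro always_eventually allI less_imp_le)
  qed simp
  show ?thesis
  proof (rule tendsto_lowerbound)
    show "(\<lambda>M. kdet n (\<lambda>i j. F (L * T (real_of_int \<lfloor>real M * x i\<rfloor> / real M -
        real_of_int \<lfloor>real M * y j\<rfloor> / real M)))) \<longlonglongrightarrow> kdet n (\<lambda>i j. F (L * T (x i - y j)))"
    proof (intro tendsto_kdet F tendsto_mult tendsto_const)
      fix i j
      have "isCont T (x i - y j)" using T by (simp add: continuous_on_eq_continuous_at)
      then show "(\<lambda>M. T (real_of_int \<lfloor>real M * x i\<rfloor> / real M - real_of_int \<lfloor>real M * y j\<rfloor> / real M))
          \<longlonglongrightarrow> T (x i - y j)"
        by (rule isCont_tendsto_compose) (intro tendsto_diff floor_scaled_tendsto)
    qed (use T L in auto)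
    show "\<forall>\<^sub>F M in sequentially. 0 \<le> kdet n (\<lambda>i j. F (L * T (real_of_int \<lfloor>real M * x i\<rfloor> / real M -
        real_of_int \<lfloor>real M * y j\<rfloor> / real M)))"
      using eventually_floor_strict_mono[OF xy(1)] eventually_floor_strict_mono[OF xy(2)]
        eventually_gt_at_top[of "0::nat"]
    proof eventually_elim
      case (elim M)
      from int[OF elim(3,1,2)] show ?case by (simp add: diff_divide_distrib)
    qed
  qed simp
qed

lemma laplace_minor_nonneg:
  assumes "L > 0" "strict_mono_on {..<n} x" "strict_mono_on {..<n} y"
  shows "kdet n (\<lambda>i j. F (L * exp (- \<bar>x i - y j\<bar>))) \<ge> 0"
  by (rule limit_kernel_minor_nonneg[OF totally_positive_laplace_seq exp_bounded_laplace_seq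
        laplace_seq_tendsto _ _ assms]) (auto intro!: continuous_intros)

lemma two_pole_minor_nonneg:
  assumes "L > 0" "strict_mono_on {..<n} x" "strict_mono_on {..<n} y"
  shows "kdet n (\<lambda>i j. F (L * two_pole (x i - y j))) \<ge> 0"
  by (rule limit_kernel_minor_nonneg[OF totally_positive_two_pole_seq exp_bounded_two_pole_seq
        two_pole_seq_tendsto continuous_two_pole two_pole_pos assms])

end

section \<open>Reduction to powers\<close>

text \<open>The derivative of \<open>exp\<close> at 0. Since \<open>a n\<close> may be 0, the
  quotient is first extended continuously by \<open>g\<close>.\<close>

lemma exp_diff_quotient_tendsto:
  fixes d a :: "nat \<Rightarrow> real"
  assumes d: "d \<longlonglongrightarrow> 0" "\<And>n. d n > 0" and a: "a \<longlonglongrightarrow> l"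
  shows "(\<lambda>n. (exp (d n * a n) - 1) / d n) \<longlonglongrightarrow> l"
proof -
  define g where "g = (\<lambda>z::real. if z = 0 then 1 else (exp z - 1) / z)"
  have "((\<lambda>z::real. (exp z - 1) / z) \<longlongrightarrow> 1) (at 0)"
    by real_asymp
  then have "(g \<longlongrightarrow> 1) (at 0)"
    by (rule Lim_transform_eventually) (auto simp: g_def eventually_at intro!: exI[of _ 1])
  then have "isCont g 0"
    by (simp add: isCont_def g_def)
  moreover have "(\<lambda>n. d n * a n) \<longlonglongrightarrow> 0"
    using tendsto_mult[OF d(1) a] by simp
  ultimately have "(\<lambda>n. g (d n * a n)) \<longlonglongrightarrow> g 0"
    by (rule isCont_tendsto_compose)
  then have "(\<lambda>n. a n * g (d n * a n)) \<longlonglongrightarrow> l * g 0"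
    using a by (intro tendsto_mult)
  moreover have "a n * g (d n * a n) = (exp (d n * a n) - 1) / d n" for n
    using d(2)[of n] by (auto simp: g_def)
  ultimately show ?thesis by (simp add: g_def)
qed

context TP_preserver
begin

section \<open>Concavity and affinity in logarithmic coordinates\<close>

definition logF :: "real \<Rightarrow> real" where "logF t = ln (F (exp t))"

lemma F_exp: "F (exp t) = exp (logF t)"
  by (simp add: logF_def pos)

lemma logF_strict_mono: "s < t \<Longrightarrow> logF s < logF t"
  unfolding logF_def by (intro ln_less_cancel_iff[THEN iffD2] pos strict_mono_pos) auto

lemma continuous_logF: "isCont logF t"
proof -
  have "isCont (\<lambda>t. F (exp t)) t"
    by (rule isCont_o2[where g = F, OF isCont_exp continuous_pos[OF exp_gt_zero]])
  moreover have "F (exp t) \<noteq> 0"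
    using pos[of "exp t"] by simp
  ultimately show ?thesis
    unfolding logF_def[abs_def] by (rule isCont_ln')
qed

text \<open>Rows at \<open>a\<close>, \<open>a + b\<close> and columns at \<open>0\<close>,
  \<open>a\<close> give the distances \<open>a, 0\<close> and \<open>a + b, b\<close>; the height
  \<open>exp t\<close> turns a distance \<open>z\<close> into the argument \<open>t - z\<close> of
  \<open>logF\<close>.\<close>

lemma logF_increments:
  assumes "a > 0" "b > 0"
  shows "logF t + logF (t - a - b) \<le> logF (t - a) + logF (t - b)"
proof -
  let ?x = "\<lambda>i::nat. if i = 0 then a else a + b" and ?y = "\<lambda>j::nat. if j = 0 then 0 else a"
  have "kdet 2 (\<lambda>i j. F (exp t * exp (- \<bar>?x i - ?y j\<bar>))) \<ge> 0"
    using assms by (intro laplace_minor_nonneg) (auto simp: strict_mono_on_def)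
  moreover have "F (exp t * exp (- \<bar>z\<bar>)) = exp (logF (t - \<bar>z\<bar>))" for z
    by (simp add: F_exp flip: exp_add)
  ultimately have "kdet 2 (\<lambda>i j. exp (logF (t - \<bar>?x i - ?y j\<bar>))) \<ge> 0"
    by simp
  also have "kdet 2 (\<lambda>i j. exp (logF (t - \<bar>?x i - ?y j\<bar>))) =
      exp (logF (t - a)) * exp (logF (t - b)) - exp (logF t) * exp (logF (t - (a + b)))"
    using assms unfolding kdet_2 by simp
  finally have "exp (logF t + logF (t - a - b)) \<le> exp (logF (t - a) + logF (t - b))"
    by (simp add: exp_add diff_diff_eq)
  then show ?thesis by simp
qed

lemma logF_increment_antimono:
  assumes "l > 0" "s \<le> t"
  shows "logF t - logF (t - l) \<le> logF s - logF (s - l)"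
  using logF_increments[of l "t - s" t] assms by (cases "s = t") (auto simp: algebra_simps)

text \<open>The chord is cut into \<open>N\<close> steps of length \<open>d\<close>. By the
  condition on \<open>c\<close> each of them ends at or right of \<open>c\<close>, so concavity
  bounds it by the step ending at \<open>c\<close>.\<close>

lemma logF_chord_le:
  assumes "d > 0" "c \<le> b - real N * d + d"
  shows "logF b - logF (b - real N * d) \<le> real N * (logF c - logF (c - d))"
  using assms(2)
proof (induction N arbitrary: b)
  case (Suc N)
  have "0 \<le> real N * d" using assms(1) by simp
  moreover have "c \<le> b - real N * d" using Suc.prems by (simp add: algebra_simps)
  ultimately have "c \<le> b" by linarith
  then have "logF b - logF (b - d) \<le> logF c - logF (c - d)"
    using assms(1) by (intro logF_increment_antimono)
  moreover have "logF (b - d) - logF (b - d - real N * d) \<le> real N * (logF c - logF (c - d))"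
    using Suc.prems by (intro Suc.IH) (auto simp: algebra_simps)
  ultimately show ?case by (simp add: algebra_simps)
qed simp

lemma logF_chord_ge:
  assumes "d > 0" "b \<le> c"
  shows "real N * (logF c - logF (c - d)) \<le> logF b - logF (b - real N * d)"
  using assms(2)
proof (induction N arbitrary: b)
  case (Suc N)
  have "logF c - logF (c - d) \<le> logF b - logF (b - d)"
    using Suc.prems assms(1) by (intro logF_increment_antimono)
  moreover have "real N * (logF c - logF (c - d)) \<le> logF (b - d) - logF (b - d - real N * d)"
    using Suc.prems assms(1) by (intro Suc.IH) auto
  ultimately show ?case by (simp add: algebra_simps)
qed simp

text \<open>Rows at \<open>d\<close>, \<open>2 * d\<close>, \<open>X\<close> and columns at
  \<open>0\<close>, \<open>d\<close>, \<open>2 * d\<close>. For the identity the last two rows are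
  proportional, since their points lie at or right of all column points; this is the degenerate
  minor to be perturbed.\<close>

lemma laplace_minor_3:
  assumes "d > 0" "X > 2 * d"
  shows "exp (logF (t - X)) * (exp (logF t) ^ 2 - exp (logF (t - d)) ^ 2)
    - exp (logF (t - X + d)) * exp (logF (t - d)) * (exp (logF t) - exp (logF (t - 2 * d)))
    + exp (logF (t - X + 2 * d)) * (exp (logF (t - d)) ^ 2 - exp (logF t) * exp (logF (t - 2 * d))) \<ge> 0"
proof -
  let ?x = "\<lambda>i::nat. if i = 0 then d else if i = 1 then 2 * d else X"
  have "kdet 3 (\<lambda>i j. F (exp t * exp (- \<bar>?x i - real j * d\<bar>))) \<ge> 0"
    using assms by (intro laplace_minor_nonneg) (auto simp: strict_mono_on_def)
  moreover have "F (exp t * exp (- \<bar>z\<bar>)) = exp (logF (t - \<bar>z\<bar>))" for z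
    by (simp add: F_exp flip: exp_add)
  ultimately have "kdet 3 (\<lambda>i j. exp (logF (t - \<bar>?x i - real j * d\<bar>))) \<ge> 0"
    by simp
  then show ?thesis
    using assms unfolding kdet_3 by (simp add: algebra_simps power2_eq_square)
qed

text \<open>
  The converse of \<open>logF_increment_antimono\<close>. In the minor of \<open>laplace_minor_3\<close> with \<open>X = t - b + l\<close>
  fixed, the second difference of \<open>logF\<close> at \<open>t\<close> is of smaller order than \<open>d\<close> along
  \<open>d = l / 2\<^sup>n\<close>; dividing by \<open>d\<^sup>2\<close> only the comparison of the slopes at \<open>t\<close> and \<open>t - X\<close> survives.
\<close>

lemma logF_increment_le:
  assumes l: "l > 0" and bt: "b - l < t"
  shows "logF b - logF (b - l) \<le> logF t - logF (t - l)"
proof -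
  \<comment> \<open>Dyadic steps make \<open>l\<close> an integer multiple of every step, as the
    chord lemmas require. \<open>\<sigma> n\<close> is the slope on
    \<open>[t - \<delta> n, t]\<close>, while \<open>M\<close> and \<open>M'\<close> are the slopes
    on \<open>[b - l, b]\<close> and \<open>[b - 2 * l, b - l]\<close>.\<close>
  define \<delta> where "\<delta> = (\<lambda>n. l / 2 ^ n)"
  define \<sigma> where "\<sigma> = (\<lambda>n. (logF t - logF (t - \<delta> n)) / \<delta> n)"
  define M where "M = (logF b - logF (b - l)) / l"
  define M' where "M' = (logF (b - l) - logF (b - 2 * l)) / l"
  have \<delta>: "\<delta> n > 0" "real (2 ^ n) * \<delta> n = l" "\<delta> n = 2 * \<delta> (Suc n)" for n
    using l by (auto simp: \<delta>_def)
  have \<sigma>: "logF (t - \<delta> n) = logF t - \<delta> n * \<sigma> n" for n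
    using \<delta>(1)[of n] by (simp add: \<sigma>_def)
  have \<delta>0: "\<delta> \<longlonglongrightarrow> 0"
    unfolding \<delta>_def by real_asymp
  have dec: "\<sigma> (Suc n) \<le> \<sigma> n" for n
  proof -
    have "2 * (logF t - logF (t - \<delta> (Suc n))) \<le> logF t - logF (t - \<delta> n)"
      using logF_chord_ge[OF \<delta>(1), of t t 2 "Suc n"] \<delta>(3)[of n] by simp
    then have "2 * (\<delta> (Suc n) * \<sigma> (Suc n)) \<le> \<delta> n * \<sigma> n"
      by (simp add: \<sigma>[of n] \<sigma>[of "Suc n"])
    then show ?thesis using \<delta>(1)[of "Suc n"] \<delta>(3)[of n] by simp
  qed
  then have "decseq \<sigma>" by (rule decseq_SucI)
  \<comment> \<open>By concavity the slopes left of \<open>t\<close> are bounded below by the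
    positive slope on \<open>[t, t + l]\<close>; this gives both convergence of
    \<open>\<sigma>\<close> and \<open>s > 0\<close>.\<close>
  have low: "(logF (t + l) - logF t) / l \<le> \<sigma> n" for n
  proof -
    have "logF (t + l) - logF (t + l - real (2 ^ n) * \<delta> n) \<le> real (2 ^ n) * (logF t - logF (t - \<delta> n))"
      using \<delta>(1)[of n] \<delta>(2)[of n] by (intro logF_chord_le) auto
    then have "logF (t + l) - logF t \<le> real (2 ^ n) * (\<delta> n * \<sigma> n)"
      unfolding \<delta>(2) \<sigma> by simp
    also have "\<dots> = l * \<sigma> n" by (simp only: \<delta>(2) mult.assoc[symmetric])
    finally show ?thesis using l by (simp add: divide_le_eq mult.commute)
  qed
  obtain s where s: "\<sigma> \<longlonglongrightarrow> s" "\<And>n. s \<le> \<sigma> n"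
    using decseq_convergent[OF \<open>decseq \<sigma>\<close>, of "(logF (t + l) - logF t) / l"] low by blast
  have "(logF (t + l) - logF t) / l > 0"
    using logF_strict_mono[of t "t + l"] l by simp
  moreover have "(logF (t + l) - logF t) / l \<le> s"
    by (intro LIMSEQ_le_const[OF s(1)] exI allI impI low)
  ultimately have "s > 0" by linarith
  \<comment> \<open>The index shift gives \<open>2 * d n = \<delta> n\<close>, so
    \<open>logF\<close> at \<open>t - 2 * d n\<close> is expressed by \<open>\<sigma> n\<close>. The
    second difference of \<open>logF\<close> there is \<open>- d n * e n\<close>, and
    \<open>e\<close> tends to 0 because \<open>\<sigma>\<close> converges.\<close>
  define d where "d = (\<lambda>n. \<delta> (Suc n))"
  define e where "e = (\<lambda>n. 2 * (\<sigma> n - \<sigma> (Suc n)))"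
  define q where "q = (\<lambda>n. exp (d n * - \<sigma> (Suc n)))"
  have d: "d n > 0" for n by (simp add: d_def \<delta>(1))
  have d0: "d \<longlonglongrightarrow> 0" unfolding d_def using \<delta>0 by (rule LIMSEQ_Suc)
  have \<sigma>': "(\<lambda>n. \<sigma> (Suc n)) \<longlonglongrightarrow> s" using s(1) by (rule LIMSEQ_Suc)
  have e0: "e \<longlonglongrightarrow> 0"
    unfolding e_def using tendsto_mult[OF tendsto_const[of 2] tendsto_diff[OF s(1) \<sigma>']] by simp
  have e: "e n \<ge> 0" for n by (simp add: e_def dec)
  have "\<forall>\<^sub>F n in sequentially. d n < (t - b + l) / 2"
    using d0 bt by (intro order_tendstoD) auto
  then have ineq: "\<forall>\<^sub>F n in sequentially.
      (1 - (q n)\<^sup>2) * (exp (d n * - M) - q n) + (q n)\<^sup>2 * (1 - exp (d n * - e n)) * (exp (d n * M') - q n) \<ge> 0"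
  proof eventually_elim
    case (elim n)
    \<comment> \<open>Near \<open>t - X = b - l\<close> only two ratios enter. Concavity replaces
      them by fixed slopes: the first step right of \<open>b - l\<close> rises at least with slope
      \<open>M\<close>, the second at most with slope \<open>M'\<close>.\<close>
    define \<rho> where "\<rho> = exp (logF (b - l) - logF (b - l + d n))"
    define \<rho>' where "\<rho>' = exp (logF (b - l + d n) - logF (b - l + 2 * d n))"
    define S where "S = exp (d n * - e n)"
    define C where "C = exp (logF (b - l + 2 * d n))"
    have N: "real (2 ^ Suc n) * d n = l" unfolding d_def by (rule \<delta>(2))
    have "logF b - logF (b - l) \<le> real (2 ^ Suc n) * (logF (b - l + d n) - logF (b - l + d n - d n))"
      using logF_chord_le[OF d, of "b - l + d n" b "2 ^ Suc n" n] unfolding N by simp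
    then have "d n * (logF b - logF (b - l)) \<le> l * (logF (b - l + d n) - logF (b - l))"
      using d[of n] by (subst N[symmetric]) (simp add: mult_ac)
    then have \<rho>: "\<rho> \<le> exp (d n * - M)"
      using l by (simp add: \<rho>_def M_def field_simps)
    have "real (2 ^ Suc n) * (logF (b - l + 2 * d n) - logF (b - l + 2 * d n - d n)) \<le> logF (b - l) - logF (b - 2 * l)"
      using logF_chord_ge[OF d, of "b - l" "b - l + 2 * d n" "2 ^ Suc n" n] d[of n] unfolding N
      by (simp add: algebra_simps)
    then have "l * (logF (b - l + 2 * d n) - logF (b - l + d n)) \<le> d n * (logF (b - l) - logF (b - 2 * l))"
      using d[of n] by (subst N[symmetric]) (simp add: mult_ac add_ac)
    then have "logF (b - l + 2 * d n) - logF (b - l + d n) \<le> d n * M'"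
      using l by (simp add: M'_def field_simps)
    moreover have "1 / \<rho>' = exp (logF (b - l + 2 * d n) - logF (b - l + d n))"
      by (simp add: \<rho>'_def exp_diff)
    ultimately have \<rho>': "1 / \<rho>' \<le> exp (d n * M')"
      by simp
    have \<rho>'0: "\<rho>' > 0" "C > 0" by (auto simp: \<rho>'_def C_def)
    have S: "S \<le> 1" using d[of n] e[of n] by (simp add: S_def)
    have "logF (t - d n) = logF t + d n * - \<sigma> (Suc n)" using \<sigma>[of "Suc n"] by (simp add: d_def)
    then have 1: "exp (logF (t - d n)) = exp (logF t) * q n"
      by (simp add: q_def exp_add[symmetric])
    have "logF (t - 2 * d n) = logF t - 2 * d n * \<sigma> n" using \<sigma>[of n] \<delta>(3)[of n] by (simp add: d_def)
    also have "\<dots> = logF t + (d n * - \<sigma> (Suc n) + d n * - \<sigma> (Suc n)) + d n * - e n"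
      by (simp add: e_def algebra_simps)
    finally have 2: "exp (logF (t - 2 * d n)) = exp (logF t) * (q n)\<^sup>2 * S"
      by (simp only: q_def S_def exp_add power2_eq_square)
    have 3: "exp (logF (b - l + d n)) = \<rho>' * C" "exp (logF (b - l)) = \<rho> * \<rho>' * C"
      by (auto simp: \<rho>_def \<rho>'_def C_def simp flip: exp_add)
    have "0 \<le> exp (logF (b - l)) * (exp (logF t) ^ 2 - exp (logF (t - d n)) ^ 2)
      - exp (logF (b - l + d n)) * exp (logF (t - d n)) * (exp (logF t) - exp (logF (t - 2 * d n)))
      + exp (logF (b - l + 2 * d n)) * (exp (logF (t - d n)) ^ 2 - exp (logF t) * exp (logF (t - 2 * d n)))"
      using laplace_minor_3[OF d, of n "t - b + l" t] elim by simp
    also have "\<dots> = (exp (logF t))\<^sup>2 * C * \<rho>' *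
        (\<rho> * (1 - (q n)\<^sup>2) - q n * (1 - (q n)\<^sup>2 * S) + (q n)\<^sup>2 * (1 - S) * (1 / \<rho>'))"
      unfolding 1 2 3 C_def[symmetric] using \<rho>'0 by (simp add: field_simps power2_eq_square)
    finally have "0 \<le> (exp (logF t))\<^sup>2 * C * \<rho>' *
        (\<rho> * (1 - (q n)\<^sup>2) - q n * (1 - (q n)\<^sup>2 * S) + (q n)\<^sup>2 * (1 - S) * (1 / \<rho>'))" .
    moreover have "0 < (exp (logF t))\<^sup>2 * C * \<rho>'"
      using \<rho>'0 by simp
    ultimately have "0 \<le> \<rho> * (1 - (q n)\<^sup>2) - q n * (1 - (q n)\<^sup>2 * S) + (q n)\<^sup>2 * (1 - S) * (1 / \<rho>')"
      by (meson mult_pos_neg not_le)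
    moreover have "(q n)\<^sup>2 \<le> 1"
      using d[of n] \<open>s > 0\<close> s(2)[of "Suc n"] by (intro power_le_one) (auto simp: q_def)
    then have "\<rho> * (1 - (q n)\<^sup>2) \<le> exp (d n * - M) * (1 - (q n)\<^sup>2)"
      using \<rho> by (intro mult_right_mono) auto
    moreover have "(q n)\<^sup>2 * (1 - S) * (1 / \<rho>') \<le> (q n)\<^sup>2 * (1 - S) * exp (d n * M')"
      using \<rho>' S by (intro mult_left_mono) auto
    ultimately have "0 \<le> exp (d n * - M) * (1 - (q n)\<^sup>2) - q n * (1 - (q n)\<^sup>2 * S) +
        (q n)\<^sup>2 * (1 - S) * exp (d n * M')"
      by linarith
    then show ?case
      unfolding S_def[symmetric] by (simp add: algebra_simps power2_eq_square)
  qed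
  \<comment> \<open>Divided by the square of the step, each factor becomes a difference quotient of
    \<open>exp\<close> at 0.\<close>
  have quot: "- ((A - 1) / r) * ((B - 1) / r - (p - 1) / r) - p\<^sup>2 * ((C - 1) / r) * ((D - 1) / r - (p - 1) / r) =
      ((1 - A) * (B - p) + p\<^sup>2 * (1 - C) * (D - p)) / (r * r)" if "r \<noteq> 0" for A B C D p r :: real
    using that by (simp add: field_simps)
  from ineq have ev: "\<forall>\<^sub>F n in sequentially.
      - ((exp (d n * (- 2 * \<sigma> (Suc n))) - 1) / d n) *
        ((exp (d n * - M) - 1) / d n - (exp (d n * - \<sigma> (Suc n)) - 1) / d n)
      - (exp (d n * - \<sigma> (Suc n)))\<^sup>2 * ((exp (d n * - e n) - 1) / d n) *
        ((exp (d n * M') - 1) / d n - (exp (d n * - \<sigma> (Suc n)) - 1) / d n) \<ge> 0"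
  proof eventually_elim
    case (elim n)
    have "(q n)\<^sup>2 = exp (d n * (- 2 * \<sigma> (Suc n)))"
      by (simp add: q_def power2_eq_square flip: exp_add)
    with elim have "0 \<le> ((1 - exp (d n * (- 2 * \<sigma> (Suc n)))) * (exp (d n * - M) - q n) +
        (q n)\<^sup>2 * (1 - exp (d n * - e n)) * (exp (d n * M') - q n)) / (d n * d n)"
      by simp
    moreover have "d n \<noteq> 0" using d[of n] by simp
    note quot[OF this, of "exp (d n * (- 2 * \<sigma> (Suc n)))" "exp (d n * - M)" "q n" "exp (d n * - e n)" "exp (d n * M')"]
    ultimately show ?case
      unfolding q_def[THEN fun_cong, symmetric] by simp
  qed
  \<comment> \<open>The second product tends to 0 along with \<open>e\<close>; the first tends to
    \<open>2 * s * (s - M)\<close>.\<close>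
  have "(\<lambda>n. - ((exp (d n * (- 2 * \<sigma> (Suc n))) - 1) / d n) *
        ((exp (d n * - M) - 1) / d n - (exp (d n * - \<sigma> (Suc n)) - 1) / d n)
      - (exp (d n * - \<sigma> (Suc n)))\<^sup>2 * ((exp (d n * - e n) - 1) / d n) *
        ((exp (d n * M') - 1) / d n - (exp (d n * - \<sigma> (Suc n)) - 1) / d n))
      \<longlonglongrightarrow> - (- 2 * s) * (- M - - s) - (exp (0 * - s))\<^sup>2 * (- 0) * (M' - - s)"
    by (intro tendsto_intros exp_diff_quotient_tendsto d0 d \<sigma>' e0)
  from tendsto_lowerbound[OF this ev] have "0 \<le> 2 * s * (s - M)"
    by (simp add: algebra_simps)
  then have "M \<le> s" using \<open>s > 0\<close> by (simp add: zero_le_mult_iff)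
  also have "s \<le> \<sigma> 0" by (rule s(2))
  also have "\<sigma> 0 = (logF t - logF (t - l)) / l" by (simp add: \<sigma>_def \<delta>_def)
  finally show ?thesis using l by (simp add: M_def divide_le_cancel)
qed

lemma logF_increment_eq:
  assumes "l > 0"
  shows "logF t - logF (t - l) = logF 0 - logF (0 - l)"
proof -
  have "logF b - logF (b - l) = logF s - logF (s - l)" if "b \<le> s" for b s
    using logF_increment_le[of l b s] logF_increment_antimono[of l b s] assms that by linarith
  from this[of t 0] this[of 0 t] show ?thesis by linarith
qed

text \<open>Increments that depend only on their length make \<open>logF - logF 0\<close> additive;
  continuity and rational approximation then make it linear.\<close>

lemma logF_affine: "logF t = logF 0 + (logF 1 - logF 0) * t"
proof -
  define A where "A = (\<lambda>x. logF x - logF 0)"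
  have shift: "logF (s + l) - logF s = logF l - logF 0" if "l > 0" for s l
    using logF_increment_eq[OF that, of "s + l"] logF_increment_eq[OF that, of l] by simp
  have add: "A (s + l) = A s + A l" for s l
  proof -
    consider "l > 0" | "l = 0" | "l < 0" by linarith
    then show ?thesis
    proof cases
      case 3
      then show ?thesis using shift[of "- l" "s + l"] shift[of "- l" l] by (simp add: A_def)
    qed (use shift[of l s] in \<open>auto simp: A_def\<close>)
  qed
  have nat: "A (real k * x) = real k * A x" for k x
  proof (induction k)
    case (Suc k)
    then show ?case using add[of x "real k * x"] by (simp add: algebra_simps)
  qed (simp add: A_def)
  have int: "A (real_of_int k * x) = real_of_int k * A x" for k x
  proof (cases "k \<ge> 0")
    case True
    then show ?thesis using nat[of "nat k" x] by simp
  next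
    case False
    then have "A (real_of_int (- k) * x) = real_of_int (- k) * A x"
      using nat[of "nat (- k)" x] by simp
    then show ?thesis
      using add[of "real_of_int k * x" "real_of_int (- k) * x"] by (simp add: A_def)
  qed
  have "(\<lambda>M. A (real_of_int \<lfloor>real M * t\<rfloor> / real M)) \<longlonglongrightarrow> A t"
    unfolding A_def
    by (intro tendsto_intros isCont_tendsto_compose[OF continuous_logF] floor_scaled_tendsto)
  moreover have "\<forall>\<^sub>F M in sequentially. A (real_of_int \<lfloor>real M * t\<rfloor> / real M) =
      real_of_int \<lfloor>real M * t\<rfloor> / real M * A 1"
    using eventually_gt_at_top[of "0::nat"]
  proof eventually_elim
    case (elim M)
    have "real M * A (1 / real M) = A 1" using nat[of M "1 / real M"] elim by simp
    then show ?case
      using int[of "\<lfloor>real M * t\<rfloor>" "1 / real M"] elim by (simp add: field_simps)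
  qed
  ultimately have "(\<lambda>M. real_of_int \<lfloor>real M * t\<rfloor> / real M * A 1) \<longlonglongrightarrow> A t"
    by (rule Lim_transform_eventually)
  moreover have "(\<lambda>M. real_of_int \<lfloor>real M * t\<rfloor> / real M * A 1) \<longlonglongrightarrow> t * A 1"
    by (intro tendsto_intros floor_scaled_tendsto)
  ultimately have "A t = t * A 1" by (rule LIMSEQ_unique)
  then show ?thesis by (simp add: A_def algebra_simps)
qed

lemma power_law:
  obtains c p where "c > 0" "p > 0" "\<And>x. x > 0 \<Longrightarrow> F x = c * x powr p"
proof
  show "exp (logF 0) > 0" "logF 1 - logF 0 > 0" using logF_strict_mono[of 0 1] by auto
  fix x :: real assume "x > 0"
  then have "F x = exp (logF 0 + (logF 1 - logF 0) * ln x)"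
    using F_exp[of "ln x"] logF_affine[of "ln x"] by simp
  then show "F x = exp (logF 0) * x powr (logF 1 - logF 0)"
    using \<open>x > 0\<close> by (simp add: exp_add powr_def)
qed

end

section \<open>The exponent\<close>

text \<open>\<open>two_pole\<close> in the multiplicative variable \<open>v = exp (2 * x)\<close>, without the factor \<open>sqrt v\<close>.\<close>

definition two_pole_mult :: "real \<Rightarrow> real" where
  "two_pole_mult v = (if v \<ge> 1 then 1 / v else 2 - v)"

lemma two_pole_eq_mult:
  assumes "v > 0"
  shows "two_pole (ln v / 2) = sqrt v * two_pole_mult v"
proof (cases "v \<ge> 1")
  case True
  have "two_pole (ln v / 2) = exp (- (ln v / 2))"
    using True by (simp add: two_pole_def)
  also have "\<dots> = 1 / sqrt v"
    using assms by (simp add: exp_minus ln_sqrt[symmetric] inverse_eq_divide)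
  also have "\<dots> = sqrt v / v"
    using assms by (simp add: real_div_sqrt field_simps)
  finally show ?thesis using True by (simp add: two_pole_mult_def)
next
  case False
  have "exp (3 * (ln v / 2)) = exp (ln v + ln v / 2)" by simp
  also have "\<dots> = v * sqrt v" using assms by (simp only: exp_add) (simp add: ln_sqrt[symmetric])
  finally have "exp (3 * (ln v / 2)) = v * sqrt v" .
  moreover have "exp (ln v / 2) = sqrt v" using assms by (simp add: ln_sqrt[symmetric])
  ultimately show ?thesis using False assms
    by (simp add: two_pole_def two_pole_mult_def algebra_simps)
qed

lemma two_pole_mult_pos: "v > 0 \<Longrightarrow> two_pole_mult v > 0"
  by (simp add: two_pole_mult_def)

text \<open>Subtract column 3 from column 2, and twice column 2 minus column 3 from column 1; what
  remains is scaled by \<open>t\<close> and by \<open>t\<^sup>2\<close>.\<close>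

lemma kdet_4_column_ops:
  "kdet 4 (\<lambda>i j. if j = 0 then a i else if j = 1 then t\<^sup>2 * b i + 2 * (t * c i) + d i
      else if j = 2 then t * c i + d i else d i) =
    t ^ 3 * kdet 4 (\<lambda>i j. if j = 0 then a i else if j = 1 then b i else if j = 2 then c i else d i)"
  unfolding kdet_4 by (simp add: algebra_simps power2_eq_square power3_eq_cube)

text \<open>Expand along column 0: the minors are Vandermonde determinants of three of four equally
  spaced points, in the ratio \<open>1 : 3 : 3 : 1\<close>.\<close>

lemma kdet_4_third_difference:
  "kdet 4 (\<lambda>i j. if j = 0 then r i else if j = 1 then p * (p - 1) * A * (a + real i * h)\<^sup>2
      else if j = 2 then - p * B * (a + real i * h) else C) =
    - (2 * h ^ 3 * p\<^sup>2 * A * B * C) * ((p - 1) * (r 3 - 3 * r 2 + 3 * r 1 - r 0))"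
  unfolding kdet_4 by (simp add: algebra_simps power2_eq_square power3_eq_cube)

context TP_preserver
begin

context
  fixes c p :: real
  assumes c: "c > 0" and p: "p > 0" and F: "\<And>x. x > 0 \<Longrightarrow> F x = c * x powr p"
begin

text \<open>Substitute \<open>x = ln u / 2\<close> and \<open>y = - ln e / 2\<close>, so increasing
  column points become a decreasing \<open>e\<close>. The square roots are row and column
  factors.\<close>

lemma two_pole_mult_minor_nonneg:
  assumes u: "strict_mono_on {..<n} u" "\<And>i. i < n \<Longrightarrow> u i > 0"
    and e: "\<And>i j. i < j \<Longrightarrow> j < n \<Longrightarrow> e j < e i" "\<And>j. j < n \<Longrightarrow> e j > 0"
  shows "kdet n (\<lambda>i j. two_pole_mult (u i * e j) powr p) \<ge> 0"
proof -
  have "0 \<le> kdet n (\<lambda>i j. F (1 * two_pole (ln (u i) / 2 - - ln (e j) / 2)))"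
    using u e by (intro two_pole_minor_nonneg) (auto simp: strict_mono_on_def)
  also have "\<dots> = kdet n (\<lambda>i j. c * sqrt (u i) powr p * sqrt (e j) powr p *
      two_pole_mult (u i * e j) powr p)"
  proof (rule kdet_cong, goal_cases)
    case (1 i j)
    then have pos: "u i > 0" "e j > 0" using u e by auto
    then have "ln (u i) / 2 - - ln (e j) / 2 = ln (u i * e j) / 2"
      by (simp add: ln_mult add_divide_distrib)
    then have "F (1 * two_pole (ln (u i) / 2 - - ln (e j) / 2)) =
        F (sqrt (u i) * sqrt (e j) * two_pole_mult (u i * e j))"
      using pos two_pole_eq_mult[of "u i * e j"] by (simp only: mult_1 real_sqrt_mult mult_pos_pos)
    also have "\<dots> = c * (sqrt (u i) * sqrt (e j) * two_pole_mult (u i * e j)) powr p"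
      using pos two_pole_mult_pos[of "u i * e j"] by (intro F mult_pos_pos) auto
    finally show ?case
      using pos two_pole_mult_pos[of "u i * e j"] by (simp add: powr_mult mult_ac)
  qed
  also have "\<dots> = (\<Prod>i<n. c * sqrt (u i) powr p) * (\<Prod>j<n. sqrt (e j) powr p) *
      kdet n (\<lambda>i j. two_pole_mult (u i * e j) powr p)"
    by (rule kdet_scale)
  finally have "0 \<le> (\<Prod>i<n. c * sqrt (u i) powr p) * (\<Prod>j<n. sqrt (e j) powr p) *
      kdet n (\<lambda>i j. two_pole_mult (u i * e j) powr p)" .
  moreover have "sqrt (u i) powr p > 0" "sqrt (e i) powr p > 0" if "i < n" for i
    using u(2)[OF that] e(2)[OF that] by simp_all
  then have "0 < (\<Prod>i<n. c * sqrt (u i) powr p) * (\<Prod>j<n. sqrt (e j) powr p)"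
    using c by (intro mult_pos_pos prod_pos) auto
  ultimately show ?thesis
    by (simp only: zero_le_mult_iff) linarith
qed

text \<open>
  Letting three of the four column points run to infinity turns their columns, after column
  operations, into \<open>u\<^sup>2, u, 1\<close> with coefficient of the sign of \<open>p - 1\<close>; the minor becomes a
  third difference.
\<close>

lemma third_difference_ineq:
  assumes a: "a > 0" and h: "h > 0"
  shows "(p - 1) * (two_pole_mult (a + 3 * h) powr p - 3 * two_pole_mult (a + 2 * h) powr p
    + 3 * two_pole_mult (a + h) powr p - two_pole_mult a powr p) \<le> 0"
proof -
  define u where "u = (\<lambda>i::nat. a + real i * h)"
  define r where "r = (\<lambda>i. two_pole_mult (u i) powr p)"
  have u: "u i > 0" for i
    using a h by (simp add: u_def add_pos_nonneg)
  \<comment> \<open>Column 0 has column point 1; the others are the columns at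
    \<open>3 * \<epsilon>\<close>, \<open>2 * \<epsilon>\<close> and \<open>\<epsilon>\<close> after
    column operations, as scaled second and first differences in \<open>\<epsilon>\<close>.
    \<open>B0\<close> is their limit.\<close>
  define B where "B = (\<lambda>\<epsilon> i j::nat. if j = 0 then r i
      else if j = 1 then ((2 - 3 * \<epsilon> * u i) powr p - 2 * (2 - 2 * \<epsilon> * u i) powr p + (2 - \<epsilon> * u i) powr p) / \<epsilon>\<^sup>2
      else if j = 2 then ((2 - 2 * \<epsilon> * u i) powr p - (2 - \<epsilon> * u i) powr p) / \<epsilon>
      else (2 - \<epsilon> * u i) powr p)"
  define B0 where "B0 = (\<lambda>i j::nat. if j = 0 then r i
      else if j = 1 then p * (p - 1) * 2 powr (p - 2) * (u i)\<^sup>2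
      else if j = 2 then - p * 2 powr (p - 1) * u i else 2 powr p)"
  have lim: "((\<lambda>\<epsilon>. B \<epsilon> i j) \<longlongrightarrow> B0 i j) (at_right 0)" for i j
  proof -
    have "((\<lambda>\<epsilon>. ((2 - 3 * \<epsilon> * v) powr p - 2 * (2 - 2 * \<epsilon> * v) powr p + (2 - \<epsilon> * v) powr p) / \<epsilon>\<^sup>2)
        \<longlongrightarrow> p * (p - 1) * 2 powr (p - 2) * v\<^sup>2) (at_right 0)" if "v > 0" for v :: real
      using that p by real_asymp (simp add: powr_diff power2_eq_square field_simps)
    moreover have "((\<lambda>\<epsilon>. ((2 - 2 * \<epsilon> * v) powr p - (2 - \<epsilon> * v) powr p) / \<epsilon>)
        \<longlongrightarrow> - p * 2 powr (p - 1) * v) (at_right 0)" if "v > 0" for v :: real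
      using that p by real_asymp (simp add: powr_diff field_simps)
    moreover have "((\<lambda>\<epsilon>. (2 - \<epsilon> * v) powr p) \<longlongrightarrow> 2 powr p) (at_right 0)" if "v > 0" for v :: real
      using that p by real_asymp
    ultimately show ?thesis
      using u unfolding B_def B0_def by auto
  qed
  have "\<forall>\<^sub>F \<epsilon> in at_right 0. kdet 4 (B \<epsilon>) \<ge> 0"
  proof -
    \<comment> \<open>The first bound keeps the column points decreasing from 1; the second puts all
      entries outside column 0 on the branch \<open>2 - v\<close>.\<close>
    have "\<forall>\<^sub>F \<epsilon> in at_right 0. \<epsilon> < min (1 / 3) (1 / (3 * u 3))"
      using u by (intro order_tendstoD(2)[OF tendsto_ident_at]) auto
    moreover have "\<forall>\<^sub>F \<epsilon> in at_right (0::real). \<epsilon> > 0"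
      by (rule eventually_at_right_less)
    ultimately show ?thesis
    proof eventually_elim
      case (elim \<epsilon>)
      define e where "e = (\<lambda>j::nat. if j = 0 then 1 else (4 - real j) * \<epsilon>)"
      have "0 \<le> kdet 4 (\<lambda>i j. two_pole_mult (u i * e j) powr p)"
      proof (rule two_pole_mult_minor_nonneg)
        show "strict_mono_on {..<4} u"
          using h by (auto simp: strict_mono_on_def u_def)
        show "e j < e i" if "i < j" "j < 4" for i j
        proof (cases "i = 0")
          case True
          have "(4 - real j) * \<epsilon> \<le> 3 * \<epsilon>"
            using that elim by (intro mult_right_mono) auto
          also have "\<dots> < 1" using elim by simp
          finally show ?thesis using True that by (simp add: e_def)
        qed (use that elim in \<open>auto simp: e_def\<close>)
      qed (use u elim in \<open>auto simp: e_def\<close>)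
      also have "\<dots> = kdet 4 (\<lambda>i j. if j = 0 then r i else (2 - (4 - real j) * \<epsilon> * u i) powr p)"
      proof (rule kdet_cong, goal_cases)
        case (1 i j)
        have "u i \<le> u 3" using 1 h by (auto simp: u_def intro!: mult_right_mono)
        then have "u i * (3 * \<epsilon>) \<le> u 3 * (3 * \<epsilon>)" using elim by (intro mult_right_mono) auto
        also have "\<dots> < 1" using elim u[of 3] by (simp add: field_simps)
        finally have "u i * (3 * \<epsilon>) < 1" .
        moreover have "u i * ((4 - real j) * \<epsilon>) \<le> u i * (3 * \<epsilon>)" if "j \<noteq> 0"
          using that elim u[of i] by (intro mult_left_mono mult_right_mono) auto
        ultimately show ?case
          by (auto simp: e_def r_def two_pole_mult_def mult_ac)
      qed
      also have "\<dots> = \<epsilon> ^ 3 * kdet 4 (B \<epsilon>)"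
      proof -
        have "kdet 4 (\<lambda>i j. if j = 0 then r i else (2 - (4 - real j) * \<epsilon> * u i) powr p) =
            kdet 4 (\<lambda>i j. if j = 0 then B \<epsilon> i 0
              else if j = 1 then \<epsilon>\<^sup>2 * B \<epsilon> i 1 + 2 * (\<epsilon> * B \<epsilon> i 2) + B \<epsilon> i 3
              else if j = 2 then \<epsilon> * B \<epsilon> i 2 + B \<epsilon> i 3 else B \<epsilon> i 3)"
        proof (rule kdet_cong, goal_cases)
          case (1 i j)
          then consider "j = 0" | "j = 1" | "j = 2" | "j = 3" by linarith
          then show ?case using elim by cases (simp_all add: B_def)
        qed
        also have "\<dots> = \<epsilon> ^ 3 * kdet 4 (\<lambda>i j. if j = 0 then B \<epsilon> i 0 else if j = 1 then B \<epsilon> i 1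
            else if j = 2 then B \<epsilon> i 2 else B \<epsilon> i 3)"
          by (rule kdet_4_column_ops)
        also have "kdet 4 (\<lambda>i j. if j = 0 then B \<epsilon> i 0 else if j = 1 then B \<epsilon> i 1
            else if j = 2 then B \<epsilon> i 2 else B \<epsilon> i 3) = kdet 4 (B \<epsilon>)"
          by (rule kdet_cong) (auto simp: B_def)
        finally show ?thesis .
      qed
      finally show ?case using elim by (simp add: zero_le_mult_iff)
    qed
  qed
  moreover have "((\<lambda>\<epsilon>. kdet 4 (B \<epsilon>)) \<longlongrightarrow> kdet 4 B0) (at_right 0)"
    by (intro tendsto_kdet lim)
  ultimately have "0 \<le> kdet 4 B0"
    by (intro tendsto_lowerbound) auto
  also have "kdet 4 B0 = - (2 * h ^ 3 * p\<^sup>2 * 2 powr (p - 2) * 2 powr (p - 1) * 2 powr p) *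
      ((p - 1) * (r 3 - 3 * r 2 + 3 * r 1 - r 0))"
    unfolding B0_def u_def by (rule kdet_4_third_difference)
  finally have "(2 * h ^ 3 * p\<^sup>2 * 2 powr (p - 2) * 2 powr (p - 1) * 2 powr p) *
      ((p - 1) * (r 3 - 3 * r 2 + 3 * r 1 - r 0)) \<le> 0"
    by simp
  moreover have "2 * h ^ 3 * p\<^sup>2 * 2 powr (p - 2) * 2 powr (p - 1) * 2 powr p > 0"
    using h p by simp
  moreover have "X \<le> 0" if "K * X \<le> 0" "K > 0" for K X :: real
    using that by (simp add: mult_le_0_iff)
  ultimately have "(p - 1) * (r 3 - 3 * r 2 + 3 * r 1 - r 0) \<le> 0"
    by blast
  then show ?thesis by (simp add: r_def u_def)
qed

text \<open>From \<open>a = 1\<close> rightwards only the branch \<open>1 / v\<close> is met, and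
  the third difference over \<open>h ^ 3\<close> tends to the third derivative of
  \<open>v powr (- p)\<close> at 1, which is negative.\<close>

lemma exponent_ge_1: "p \<ge> 1"
proof -
  have "((\<lambda>h. (p - 1) * (((1 / (1 + 3 * h)) powr p - 3 * (1 / (1 + 2 * h)) powr p
      + 3 * (1 / (1 + h)) powr p - 1) / h ^ 3)) \<longlongrightarrow> (p - 1) * (- (p * (p + 1) * (p + 2)))) (at_right 0)"
    using p by real_asymp (simp add: algebra_simps)
  moreover have "\<forall>\<^sub>F h in at_right 0. (p - 1) * (((1 / (1 + 3 * h)) powr p - 3 * (1 / (1 + 2 * h)) powr p
      + 3 * (1 / (1 + h)) powr p - 1) / h ^ 3) \<le> 0"
    using eventually_at_right_less[of "0::real"]
  proof eventually_elim
    case (elim h)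
    then show ?case
      using third_difference_ineq[of 1 h] by (simp add: two_pole_mult_def divide_le_0_iff)
  qed
  ultimately have "(p - 1) * (- (p * (p + 1) * (p + 2))) \<le> 0"
    by (intro tendsto_upperbound) auto
  then have "0 \<le> (p - 1) * (p * (p + 1) * (p + 2))" by simp
  moreover have "p * (p + 1) * (p + 2) > 0" using p by simp
  ultimately show ?thesis by (simp add: zero_le_mult_iff)
qed

text \<open>The second derivative of \<open>two_pole_mult\<^sup>p\<close> jumps upwards at \<open>1\<close>.\<close>

lemma exponent_le_1: "p \<le> 1"
proof -
  \<comment> \<open>The window is \<open>1 - 2 * h, 1 - h, 1, 1 + h\<close>. Its third difference is
    of order \<open>h\<^sup>2\<close>: the second difference centred at 1 picks up half of the jump
    \<open>2 * p\<close>, the one centred at \<open>1 - h\<close> none of it.\<close>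
  have "((\<lambda>h. (p - 1) * (((1 / (1 + h)) powr p - 3 + 3 * (1 + h) powr p - (1 + 2 * h) powr p) / h\<^sup>2))
      \<longlongrightarrow> (p - 1) * p) (at_right 0)"
    using p by real_asymp
  moreover have "\<forall>\<^sub>F h in at_right (0::real). h < 1 / 2"
    by (intro order_tendstoD(2)[OF tendsto_ident_at]) simp
  then have "\<forall>\<^sub>F h in at_right 0. (p - 1) *
      (((1 / (1 + h)) powr p - 3 + 3 * (1 + h) powr p - (1 + 2 * h) powr p) / h\<^sup>2) \<le> 0"
    using eventually_at_right_less[of "0::real"]
  proof eventually_elim
    case (elim h)
    then have "(p - 1) * (two_pole_mult (1 + h) powr p - 3 * two_pole_mult 1 powr p
        + 3 * two_pole_mult (1 - h) powr p - two_pole_mult (1 - 2 * h) powr p) \<le> 0"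
      using third_difference_ineq[of "1 - 2 * h" h] by (simp add: algebra_simps)
    then show ?case
      using elim by (simp add: two_pole_mult_def divide_le_0_iff add.commute)
  qed
  ultimately have "(p - 1) * p \<le> 0"
    by (intro tendsto_upperbound) auto
  then show ?thesis using p by (simp add: mult_le_0_iff)
qed

end

lemma linear: "\<exists>c>0. \<forall>x>0. F x = c * x"
proof -
  obtain c p where F: "c > 0" "p > 0" "\<And>x. x > 0 \<Longrightarrow> F x = c * x powr p"
    using power_law by blast
  then have "p = 1" using exponent_ge_1 exponent_le_1 by (meson antisym)
  then show ?thesis using F by auto
qed

end

section \<open>Positive multiples and the three equivalences\<close>

lemma linear_comp_totally_positive:
  assumes "totally_positive \<Lambda>" "c > 0" "\<forall>x>0. F x = c * x"
  shows "totally_positive (F \<circ> \<Lambda>)" "F \<circ> \<Lambda> = (\<lambda>z. c * \<Lambda> z)"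
proof -
  show "F \<circ> \<Lambda> = (\<lambda>z. c * \<Lambda> z)"
    using totally_positive_imp_pos[OF assms(1)] assms(3) by (simp add: fun_eq_iff)
  then show "totally_positive (F \<circ> \<Lambda>)"
    using totally_positive_cmult[OF assms(1,2)] by simp
qed

theorem theorem5p6:
  fixes F :: "real \<Rightarrow> real"
  assumes "F \<in> {0<..} \<rightarrow> {0<..}"
  shows "(composition_preserves F TP_Polya_frequency_functions \<longleftrightarrow>
            (\<exists>c::real. c > 0 \<and> (\<forall>x>0. F x = c * x))) \<and>
         (composition_preserves F TP_Polya_frequency_sequences \<longleftrightarrow>
            (\<exists>c::real. c > 0 \<and> (\<forall>x>0. F x = c * x))) \<and>
         (composition_preserves F TP_functions \<longleftrightarrow>
            (\<exists>c::real. c > 0 \<and> (\<forall>x>0. F x = c * x)))"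
proof -
  have restrict: "totally_positive (\<lambda>k::int. \<Lambda> (real_of_int k))" if "totally_positive \<Lambda>" for \<Lambda>
    unfolding totally_positive_iff
  proof (intro allI impI)
    fix n and x y :: "nat \<Rightarrow> int"
    assume "strict_mono_on {..<n} x" "strict_mono_on {..<n} y"
    then have "strict_mono_on {..<n} (\<lambda>i. real_of_int (x i))" "strict_mono_on {..<n} (\<lambda>i. real_of_int (y i))"
      by (auto simp: strict_mono_on_def)
    then show "kdet n (\<lambda>i j. \<Lambda> (real_of_int (x i - y j))) > 0"
      using that[unfolded totally_positive_iff] by simp
  qed
  have linear: "\<exists>c>0. \<forall>x>0. F x = c * x"
    if "\<And>\<Lambda>. totally_positive \<Lambda> \<Longrightarrow> integrable lebesgue \<Lambda> \<Longrightarrow>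
      totally_positive (\<lambda>k::int. F (\<Lambda> (real_of_int k)))"
  proof -
    interpret TP_preserver F
      using assms that by unfold_locales auto
    show ?thesis by (rule linear)
  qed
  have "\<exists>c>0. \<forall>x>0. F x = c * x" if pres: "composition_preserves F TP_Polya_frequency_functions"
  proof (rule linear)
    fix \<Lambda> :: "real \<Rightarrow> real"
    assume "totally_positive \<Lambda>" "integrable lebesgue \<Lambda>"
    then have "totally_positive (F \<circ> \<Lambda>)"
      using pres unfolding composition_preserves_def TP_Polya_frequency_functions_def by blast
    from restrict[OF this] show "totally_positive (\<lambda>k::int. F (\<Lambda> (real_of_int k)))"
      by (simp only: o_apply)
  qed
  moreover have "\<exists>c>0. \<forall>x>0. F x = c * x" if pres: "composition_preserves F TP_Polya_frequency_sequences"
  proof (rule linear)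
    fix \<Lambda> :: "real \<Rightarrow> real"
    assume "totally_positive \<Lambda>"
    from restrict[OF this] have "totally_positive (F \<circ> (\<lambda>k::int. \<Lambda> (real_of_int k)))"
      using pres unfolding composition_preserves_def TP_Polya_frequency_sequences_def by blast
    then show "totally_positive (\<lambda>k::int. F (\<Lambda> (real_of_int k)))"
      by (simp only: o_def)
  qed
  moreover have "\<exists>c>0. \<forall>x>0. F x = c * x" if pres: "composition_preserves F TP_functions"
  proof (rule linear)
    fix \<Lambda> :: "real \<Rightarrow> real"
    assume "totally_positive \<Lambda>"
    then have "totally_positive (F \<circ> \<Lambda>)"
      using pres unfolding composition_preserves_def TP_functions_def by blast
    from restrict[OF this] show "totally_positive (\<lambda>k::int. F (\<Lambda> (real_of_int k)))"
      by (simp only: o_apply)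
  qed
  moreover have "composition_preserves F TP_Polya_frequency_functions \<and>
      composition_preserves F TP_Polya_frequency_sequences \<and> composition_preserves F TP_functions"
    if "c > 0" "\<forall>x>0. F x = c * x" for c
  proof -
    have "F \<circ> \<Lambda> \<in> TP_Polya_frequency_functions" if "\<Lambda> \<in> TP_Polya_frequency_functions" for \<Lambda>
    proof -
      have \<Lambda>: "totally_positive \<Lambda>" "integrable lebesgue \<Lambda>"
        using that by (simp_all add: TP_Polya_frequency_functions_def)
      note F = linear_comp_totally_positive[OF \<Lambda>(1) \<open>c > 0\<close> \<open>\<forall>x>0. F x = c * x\<close>]
      have "integrable lebesgue (F \<circ> \<Lambda>)" unfolding F(2) using \<Lambda>(2) by simp
      with F(1) show ?thesis by (simp add: TP_Polya_frequency_functions_def)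
    qed
    moreover have "composition_preserves F TP_functions"
        "composition_preserves F TP_Polya_frequency_sequences"
      unfolding composition_preserves_def TP_functions_def TP_Polya_frequency_sequences_def
      by (auto intro: linear_comp_totally_positive(1)[OF _ that])
    ultimately show ?thesis
      unfolding composition_preserves_def by blast
  qed
  ultimately show ?thesis by blast
qed

end
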